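(* Let $\mathcal{O}=\mathbb{F}_q[t]$ and $K=\mathbb{F}_q(t)$. Let $T,Y>0$. Fix two polynomials $H_0,H_1\in\mathcal{O}[c_1,\dots,c_n]$ that are relatively prime in $K[c_1,\dots,c_n]$. Then for every $\varepsilon>0$, $$\#\left\{\mathbf{c}\in\mathcal{O}^n:\ |\mathbf{c}|\le\hat T,\ \text{there exists a square-free } r\in\mathcal{O}^+\text{ with } r\mid\gcd(H_0(\mathbf{c}),H_1(\mathbf{c}))\text{ and }|r|=\hat Y\right\}\ll_\varepsilon\hat Y^\varepsilon\left(\frac{\hat T^n}{\hat Y}+\hat T^{n-1}\right).$$
   Context: $\mathcal{O}^+$ is the set of monic polynomials in $\mathcal{O}$; $|a|=q^{\deg a}$ for $a\in\mathcal{O}$ ($|0|=0$), $|\mathbf{c}|=\max_i|c_i|$, and $\hat M=q^M$ for $M\in\mathbb{R}$. The implied constant may depend on $q,n,H_0,H_1,\varepsilon$ but not on $T,Y$. *)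

theory Defs
  imports
    Complex_Main
    "HOL-Library.Cardinality"
    "HOL-Library.Poly_Mapping"
    "HOL-Computational_Algebra.Computational_Algebra"
begin

text \<open>
  The finite field with q elements is a type \<open>'a :: {field_gcd, finite}\<close>, with
  \<open>q = CARD('a)\<close>. The class \<^class>\<open>field_gcd\<close> puts no mathematical restriction on the field:
  every field admits its (trivial) Euclidean operations, and they are what makes the library's
  \<^const>\<open>gcd\<close> available on \<open>'a poly\<close>.
\<close>

definition hat :: "'a itself \<Rightarrow> real \<Rightarrow> real"
  where "hat _ M = real CARD('a) powr M"

definition poly_norm :: "'a::{zero,finite} poly \<Rightarrow> real"
  where "poly_norm a = (if a = 0 then 0 else real CARD('a) ^ degree a)"

definition vec_norm :: "('n::finite \<Rightarrow> 'a::{zero,finite} poly) \<Rightarrow> real"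
  where "vec_norm c = Max (range (\<lambda>i. poly_norm (c i)))"

text \<open>
  Polynomials over R in variables indexed by a finite type \<open>'n\<close>: finitely supported maps from
  exponent vectors to coefficients, with the (convolution) ring structure that
  \<^theory>\<open>HOL-Library.Poly_Mapping\<close> provides.
\<close>

type_synonym ('n, 'r) mpoly = "('n \<Rightarrow>\<^sub>0 nat) \<Rightarrow>\<^sub>0 'r"

definition mpoly_eval :: "('n::finite, 'r::comm_semiring_1) mpoly \<Rightarrow> ('n \<Rightarrow> 'r) \<Rightarrow> 'r"
  where "mpoly_eval H c =
    (\<Sum>m\<in>Poly_Mapping.keys H. Poly_Mapping.lookup H m * (\<Prod>i\<in>UNIV. c i ^ Poly_Mapping.lookup m i))"

definition mpoly_to_fract :: "('n, 'r::idom) mpoly \<Rightarrow> ('n, 'r fract) mpoly"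
  where "mpoly_to_fract H = Poly_Mapping.map to_fract H"

text \<open>
  Same condition as \<^const>\<open>coprime\<close>, whose type class needs a division operation
  that \<^type>\<open>poly_mapping\<close> does not have.
\<close>

definition relatively_prime :: "'r::comm_semiring_1 \<Rightarrow> 'r \<Rightarrow> bool"
  where "relatively_prime a b \<longleftrightarrow> (\<forall>d. d dvd a \<longrightarrow> d dvd b \<longrightarrow> d dvd 1)"

text \<open>Cardinalities of sets of vectors of bounded norm are genuine (not the junk value 0).\<close>

lemma finite_vec_norm_le:
  "finite {c :: 'n::finite \<Rightarrow> 'a::{field_gcd,finite} poly. vec_norm c \<le> B}"
proof -
  have q: "2 \<le> real CARD('a)"
    using card_mono[of "UNIV :: 'a set" "{0, 1}"] by simp
  obtain d :: nat where d: "B < 2 ^ d"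
    using real_arch_pow[of 2 B] by auto
  have deg: "degree a \<le> d" if "poly_norm a \<le> B" for a :: "'a poly"
  proof (rule ccontr)
    assume "\<not> degree a \<le> d"
    then have "d \<le> degree a" "a \<noteq> 0" by auto
    have "(2::real) ^ d \<le> 2 ^ degree a"
      using \<open>d \<le> degree a\<close> by (intro power_increasing) auto
    also have "\<dots> \<le> real CARD('a) ^ degree a"
      using q by (intro power_mono) auto
    finally show False
      using that d \<open>a \<noteq> 0\<close> by (simp add: poly_norm_def)
  qed
  have "{a :: 'a poly. poly_norm a \<le> B} \<subseteq> Poly ` {xs. set xs \<subseteq> UNIV \<and> length xs \<le> Suc d}"
  proof
    fix a :: "'a poly"
    assume "a \<in> {a. poly_norm a \<le> B}"
    then have "degree a \<le> d" using deg by simp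
    then have "length (coeffs a) \<le> Suc d" by (simp add: coeffs_def)
    then show "a \<in> Poly ` {xs. set xs \<subseteq> UNIV \<and> length xs \<le> Suc d}"
      by (intro image_eqI[of _ _ "coeffs a"]) auto
  qed
  then have fin: "finite {a :: 'a poly. poly_norm a \<le> B}"
    by (rule finite_subset) (intro finite_imageI finite_lists_length_le; simp)
  have "{c :: 'n \<Rightarrow> 'a poly. vec_norm c \<le> B} \<subseteq> (UNIV \<rightarrow>\<^sub>E {a. poly_norm a \<le> B})"
    by (auto simp: vec_norm_def)
  moreover have "finite ((UNIV :: 'n set) \<rightarrow>\<^sub>E {a :: 'a poly. poly_norm a \<le> B})"
    using fin by (intro finite_PiE) auto
  ultimately show ?thesis by (rule finite_subset)
qed

end

theory Submission
  imports Defs "HOL-Library.Function_Algebras"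
begin

text \<open>
  Fix a direction \<open>l\<close> along which \<open>H0\<close> has constant leading coefficient. Since \<open>H0\<close> and \<open>H1\<close> are
  relatively prime over the unique factorization domain of polynomials, the ideal they generate
  contains some \<open>R \<noteq> 0\<close> that is invariant under translation along \<open>l\<close>; it is found by eliminating
  one variable after a shear. The points with \<open>R(c) = 0\<close> number \<open>O(T\<^sup>n / T)\<close>. For the others, \<open>r\<close>
  divides \<open>R(c)\<close>, so that on a line in direction \<open>l\<close> there are on average \<open>O(Y\<^sup>\<epsilon>)\<close> candidates for
  \<open>r\<close>, and for each of them the condition \<open>r | H0\<close> confines the points of the line to
  \<open>O(Y\<^sup>\<epsilon>)\<close> residue classes modulo \<open>r\<close> by the Chinese remainder theorem.
\<close>

section \<open>Factorial subdomains and polynomials over them\<close>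

text \<open>Summing over \<open>r\<close> directly fails once \<open>r\<close> has larger degree
  than the side of the box: each \<open>r\<close> may still cost one point per line, and there are
  about \<open>q ^ Y\<close> of them. The eliminant \<open>R\<close> repairs this, since outside its
  zeros \<open>r\<close> must be one of the few divisors of a nonzero value. Its invariance along
  \<open>l\<close> matters just as much: the list of candidates for \<open>r\<close> is then the
  same at all points of a line, so the roots of \<open>H0\<close> modulo each candidate can be
  counted on that line. A coordinate direction would make the elimination immediate, but there
  \<open>H0\<close> may have a leading coefficient that varies from line to line and shares large
  factors with \<open>r\<close>; hence the skew direction and the shear.

  Factorization is developed for carrier sets inside a ring, not for types: the rings of polynomial
  functions in more and more variables then all live in one function type, and adjoining a variable
  is a change of carrier. Functions can stand for polynomials because the points range over an
  infinite set.\<close>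

definition dvd_in :: "'r::comm_ring_1 set \<Rightarrow> 'r \<Rightarrow> 'r \<Rightarrow> bool"
  where "dvd_in D a b \<longleftrightarrow> (\<exists>c\<in>D. b = a * c)"

definition unit_in :: "'r::comm_ring_1 set \<Rightarrow> 'r \<Rightarrow> bool"
  where "unit_in D u \<longleftrightarrow> u \<in> D \<and> dvd_in D u 1"

definition prime_in :: "'r::comm_ring_1 set \<Rightarrow> 'r \<Rightarrow> bool"
  where "prime_in D p \<longleftrightarrow> p \<in> D \<and> p \<noteq> 0 \<and> \<not> unit_in D p \<and>
    (\<forall>a\<in>D. \<forall>b\<in>D. dvd_in D p (a * b) \<longrightarrow> dvd_in D p a \<or> dvd_in D p b)"

text \<open>Primes instead of irreducibles: uniqueness of the factorization is then automatic, and
  existence alone makes a domain factorial. The index counts the primes and serves as an induction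
  measure.\<close>

inductive factors_in :: "'r::comm_ring_1 set \<Rightarrow> nat \<Rightarrow> 'r \<Rightarrow> bool" for D
  where
    unit: "unit_in D u \<Longrightarrow> factors_in D 0 u"
  | prime: "prime_in D p \<Longrightarrow> factors_in D n a \<Longrightarrow> factors_in D (Suc n) (p * a)"

text \<open>The ambient ring may have zero divisors, as rings of functions do; only the carrier is
  required to be a domain.\<close>

locale subdomain =
  fixes D :: "'r::comm_ring_1 set"
  assumes one [simp]: "1 \<in> D"
    and diff: "a \<in> D \<Longrightarrow> b \<in> D \<Longrightarrow> a - b \<in> D"
    and mult: "a \<in> D \<Longrightarrow> b \<in> D \<Longrightarrow> a * b \<in> D"
    and no_zero_divisors: "a \<in> D \<Longrightarrow> b \<in> D \<Longrightarrow> a * b = 0 \<Longrightarrow> a = 0 \<or> b = 0"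
begin

lemma zero [simp]: "0 \<in> D"
  using diff[of 1 1] by simp

lemma add: "a \<in> D \<Longrightarrow> b \<in> D \<Longrightarrow> a + b \<in> D"
  using diff[of a "0 - b"] diff[of 0 b] by simp

lemma sum: "(\<And>i. i \<in> I \<Longrightarrow> f i \<in> D) \<Longrightarrow> sum f I \<in> D"
  by (induction I rule: infinite_finite_induct) (auto intro: add)

lemma cancel_left:
  assumes "a \<in> D" "b \<in> D" "c \<in> D" "a \<noteq> 0" "a * b = a * c"
  shows "b = c"
  using no_zero_divisors[of a "b - c"] assms diff[of b c] by (simp add: algebra_simps)

lemma dvd_in_refl: "dvd_in D a a"
  unfolding dvd_in_def by (rule bexI[of _ 1]) simp_all

lemma dvd_in_trans: "dvd_in D a b \<Longrightarrow> dvd_in D b c \<Longrightarrow> dvd_in D a c"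
  unfolding dvd_in_def using mult by (metis mult.assoc)

lemma dvd_in_mult: "dvd_in D a b \<Longrightarrow> c \<in> D \<Longrightarrow> dvd_in D a (b * c)"
  unfolding dvd_in_def using mult by (metis mult.assoc)

lemma dvd_in_mult_left: "dvd_in D a b \<Longrightarrow> c \<in> D \<Longrightarrow> dvd_in D a (c * b)"
  using dvd_in_mult[of a b c] by (simp add: mult.commute)

lemma dvd_in_add: "dvd_in D a b \<Longrightarrow> dvd_in D a c \<Longrightarrow> dvd_in D a (b + c)"
  unfolding dvd_in_def using add by (metis distrib_left)

lemma dvd_in_diff: "dvd_in D a b \<Longrightarrow> dvd_in D a c \<Longrightarrow> dvd_in D a (b - c)"
  unfolding dvd_in_def using diff by (metis right_diff_distrib)

lemma dvd_in_0: "dvd_in D a 0"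
  unfolding dvd_in_def by (rule bexI[of _ 0]) auto

lemma dvd_in_sum: "(\<And>i. i \<in> I \<Longrightarrow> dvd_in D a (f i)) \<Longrightarrow> dvd_in D a (sum f I)"
  by (induction I rule: infinite_finite_induct) (auto intro: dvd_in_add dvd_in_0)

lemma unit_in_mult:
  assumes "unit_in D u" "unit_in D v"
  shows "unit_in D (u * v)"
proof -
  from assms obtain u' v' where "u \<in> D" "v \<in> D" "u' \<in> D" "v' \<in> D" "1 = u * u'" "1 = v * v'"
    unfolding unit_in_def dvd_in_def by blast
  moreover from this have "1 = (u * v) * (u' * v')"
    by (metis mult.assoc mult.commute mult_1_right)
  ultimately show ?thesis unfolding unit_in_def dvd_in_def using mult by blast
qed

lemma unit_in_nonzero: "unit_in D u \<Longrightarrow> u \<noteq> 0"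
  unfolding unit_in_def dvd_in_def by (metis mult_zero_left zero_neq_one)

lemma dvd_unit_in: "a \<in> D \<Longrightarrow> dvd_in D a u \<Longrightarrow> unit_in D u \<Longrightarrow> unit_in D a"
  unfolding unit_in_def using dvd_in_trans by blast

lemma factors_in_closed: "factors_in D n a \<Longrightarrow> a \<in> D \<and> a \<noteq> 0"
proof (induction rule: factors_in.induct)
  case (unit u)
  then show ?case using unit_in_nonzero by (auto simp: unit_in_def)
next
  case (prime p n a)
  then show ?case using mult no_zero_divisors unfolding prime_in_def by blast
qed

lemma unit_mult_factors_in:
  assumes "factors_in D n a" "unit_in D u"
  shows "factors_in D n (u * a)"
  using assms
proof (induction rule: factors_in.induct)
  case (unit v)
  then show ?case by (auto intro: factors_in.unit unit_in_mult)
next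
  case (prime p n a)
  then have "factors_in D (Suc n) (p * (u * a))" by (intro factors_in.prime) auto
  then show ?case by (simp add: mult.left_commute)
qed

lemma factors_in_mult:
  assumes "factors_in D n a" "factors_in D m b"
  shows "\<exists>k. factors_in D k (a * b)"
  using assms
proof (induction rule: factors_in.induct)
  case (unit u)
  then show ?case using unit_mult_factors_in by blast
next
  case (prime p n a)
  then obtain k where "factors_in D k (a * b)" by blast
  then have "factors_in D (Suc k) (p * (a * b))" using prime by (intro factors_in.prime)
  then show ?case by (auto simp: mult.assoc)
qed

text \<open>Writing \<open>q = p * w\<close>, the prime \<open>q\<close> divides \<open>p\<close> or
  \<open>w\<close>. The first makes \<open>w\<close> a unit; the second would make \<open>p\<close>
  a unit.\<close>

lemma prime_in_dvd_prime_in: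
  assumes p: "prime_in D p" and q: "prime_in D q" and "dvd_in D p q"
  shows "\<exists>w. unit_in D w \<and> q = p * w"
proof -
  from \<open>dvd_in D p q\<close> obtain w where w: "w \<in> D" "q = p * w" unfolding dvd_in_def by blast
  have D: "p \<in> D" "q \<in> D" "p \<noteq> 0" "q \<noteq> 0" using p q by (auto simp: prime_in_def)
  have "dvd_in D q (p * w)" using w dvd_in_refl by simp
  then consider "dvd_in D q p" | "dvd_in D q w"
    using q w D unfolding prime_in_def by blast
  then show ?thesis
  proof cases
    case 1
    then obtain v where v: "v \<in> D" "p = q * v" unfolding dvd_in_def by blast
    have "p * (w * v) = p * 1" using v(2)[symmetric] w(2)[symmetric] by (simp add: mult.assoc[symmetric])
    then have "w * v = 1" using cancel_left[OF D(1) mult[OF w(1) v(1)] one D(3)] by blast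
    then have "unit_in D w" using w(1) v(1) unfolding unit_in_def dvd_in_def by metis
    then show ?thesis using w(2) by blast
  next
    case 2
    then obtain v where v: "v \<in> D" "w = q * v" unfolding dvd_in_def by blast
    have "q * (p * v) = q * 1" using v(2)[symmetric] w(2)[symmetric] by (simp add: mult.left_commute)
    then have "p * v = 1" using cancel_left[OF D(2) mult[OF D(1) v(1)] one D(4)] by blast
    then have "unit_in D p" using D(1) v(1) unfolding unit_in_def dvd_in_def by metis
    then show ?thesis using p by (simp add: prime_in_def)
  qed
qed

text \<open>The first prime \<open>q\<close> of the factorization divides \<open>p * b\<close>. If
  it divides \<open>p\<close>, the two are associates and cancel; otherwise it is split off from
  \<open>b\<close> and the induction continues. The termination of \<open>prime_free_part\<close>
  rests on the strict drop of the count.\<close>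

lemma factors_in_prime_div:
  assumes "factors_in D n a" "prime_in D p" "a = p * b" "b \<in> D"
  shows "\<exists>n'<n. factors_in D n' b"
  using assms
proof (induction arbitrary: b rule: factors_in.induct)
  case (unit u)
  then have "unit_in D p"
    by (intro dvd_unit_in[of p u]) (auto simp: dvd_in_def prime_in_def)
  then show ?case using unit by (simp add: prime_in_def)
next
  case (prime q n a)
  have aD: "a \<in> D" using factors_in_closed prime by blast
  have D: "p \<in> D" "q \<in> D" "p \<noteq> 0" "q \<noteq> 0" using prime by (auto simp: prime_in_def)
  have "p * b = q * a" using prime.prems by simp
  then have "dvd_in D q (p * b)" using aD unfolding dvd_in_def by blast
  then consider "dvd_in D q p" | "dvd_in D q b"
    using \<open>prime_in D q\<close> D \<open>b \<in> D\<close> unfolding prime_in_def by blast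
  then show ?case
  proof cases
    case 1
    then obtain w where w: "unit_in D w" "p = q * w"
      using prime_in_dvd_prime_in prime by blast
    then have "w \<in> D" by (simp add: unit_in_def)
    have "q * a = q * (w * b)" unfolding prime.prems(2) w(2) by (simp add: mult.assoc)
    then have a: "a = w * b"
      using cancel_left[OF D(2) aD mult[OF \<open>w \<in> D\<close> \<open>b \<in> D\<close>] D(4)] by blast
    from w obtain v where v: "v \<in> D" "1 = w * v" by (auto simp: unit_in_def dvd_in_def)
    have "unit_in D v" using v \<open>w \<in> D\<close> unfolding unit_in_def dvd_in_def by (metis mult.commute)
    moreover have "b = v * a"
    proof -
      have "v * a = (w * v) * b" unfolding a by (simp only: mult_ac)
      then show ?thesis using v by simp
    qed
    ultimately show ?thesis using unit_mult_factors_in prime.hyps by blast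
  next
    case 2
    then obtain b' where b': "b' \<in> D" "b = q * b'" unfolding dvd_in_def by blast
    have "q * a = q * (p * b')" unfolding prime.prems(2) b'(2) by (simp add: mult.left_commute)
    then have "a = p * b'" using cancel_left[OF D(2) aD mult[OF D(1) b'(1)] D(4)] by blast
    then obtain n' where "n' < n" "factors_in D n' b'"
      using prime.IH[of b', OF prime.prems(1)] b' by blast
    then have "Suc n' < Suc n" "factors_in D (Suc n') b"
      using b' prime.hyps by (auto intro: factors_in.prime)
    then show ?thesis by blast
  qed
qed

end

section \<open>Polynomials with coefficients in a subdomain; Gauss's lemma\<close>

definition polys_over :: "'r::comm_ring_1 set \<Rightarrow> 'r poly set"
  where "polys_over D = {p. \<forall>n. coeff p n \<in> D}"

text \<open>Primitivity, phrased without a content: over a factorial carrier, unit content means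
  that no prime divides every coefficient.\<close>

definition prime_free :: "'r::comm_ring_1 set \<Rightarrow> 'r poly \<Rightarrow> bool"
  where "prime_free D f \<longleftrightarrow> \<not> (\<exists>p. prime_in D p \<and> (\<forall>n. dvd_in D p (coeff f n)))"

context subdomain begin

lemma polys_overD: "p \<in> polys_over D \<Longrightarrow> coeff p n \<in> D"
  by (simp add: polys_over_def)

text \<open>A product of leading coefficients could vanish in the ambient ring; coefficients in
  \<open>D\<close> exclude this.\<close>

lemma nonzero_degree_mult_polys_over:
  assumes "f \<in> polys_over D" "g \<in> polys_over D" "f \<noteq> 0" "g \<noteq> 0"
  shows "f * g \<noteq> 0" "degree (f * g) = degree f + degree g"
proof -
  have "coeff (f * g) (degree f + degree g) = lead_coeff f * lead_coeff g"
    by (rule coeff_mult_degree_sum)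
  moreover have "lead_coeff f * lead_coeff g \<noteq> 0"
    using no_zero_divisors[of "lead_coeff f" "lead_coeff g"] assms polys_overD by auto
  ultimately have *: "coeff (f * g) (degree f + degree g) \<noteq> 0" by simp
  then show "f * g \<noteq> 0" by auto
  from * have "degree f + degree g \<le> degree (f * g)" by (rule le_degree)
  then show "degree (f * g) = degree f + degree g"
    using degree_mult_le[of f g] by linarith
qed

lemma const_in_polys_over: "a \<in> D \<Longrightarrow> [:a:] \<in> polys_over D"
  by (auto simp: polys_over_def coeff_pCons split: nat.splits)

lemma monom_in_polys_over: "a \<in> D \<Longrightarrow> monom a n \<in> polys_over D"
  by (auto simp: polys_over_def)

lemma subdomain_polys_over: "subdomain (polys_over D)"
proof
  show "1 \<in> polys_over D" using const_in_polys_over[of 1] by (simp add: one_pCons)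
next
  fix p q assume pq: "p \<in> polys_over D" "q \<in> polys_over D"
  then show "p - q \<in> polys_over D" by (auto simp: polys_over_def intro: diff)
  show "p * q \<in> polys_over D"
    using pq by (auto simp: polys_over_def coeff_mult intro!: sum mult)
  show "p * q = 0 \<Longrightarrow> p = 0 \<or> q = 0"
    using nonzero_degree_mult_polys_over(1) pq by blast
qed

interpretation E: subdomain "polys_over D"
  by (rule subdomain_polys_over)

lemma smult_in_polys_over: "a \<in> D \<Longrightarrow> f \<in> polys_over D \<Longrightarrow> smult a f \<in> polys_over D"
  by (auto simp: polys_over_def intro: mult)

lemma smult_cancel_polys_over:
  assumes "a \<in> D" "a \<noteq> 0" "f \<in> polys_over D" "g \<in> polys_over D" "smult a f = smult a g"
  shows "f = g"
  using E.cancel_left[of "[:a:]" f g] assms const_in_polys_over by simp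

lemma const_dvd_in_polys_over_iff:
  assumes "f \<in> polys_over D"
  shows "dvd_in (polys_over D) [:a:] f \<longleftrightarrow> (\<forall>n. dvd_in D a (coeff f n))"
proof
  assume "dvd_in (polys_over D) [:a:] f"
  then obtain g where "g \<in> polys_over D" "f = [:a:] * g" unfolding dvd_in_def by blast
  then show "\<forall>n. dvd_in D a (coeff f n)"
    by (auto simp: dvd_in_def polys_over_def)
next
  assume "\<forall>n. dvd_in D a (coeff f n)"
  then obtain c where c: "\<And>n. c n \<in> D" "\<And>n. coeff f n = a * c n"
    unfolding dvd_in_def by metis
  let ?g = "\<Sum>i\<le>degree f. monom (c i) i"
  have "f = (\<Sum>i\<le>degree f. monom (coeff f i) i)" by (simp add: poly_as_sum_of_monoms)
  also have "\<dots> = [:a:] * ?g"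
    by (simp add: c(2) sum_distrib_left smult_monom)
  finally have "f = [:a:] * ?g" .
  moreover have "?g \<in> polys_over D" by (intro E.sum monom_in_polys_over c)
  ultimately show "dvd_in (polys_over D) [:a:] f" unfolding dvd_in_def by blast
qed

text \<open>Gauss's lemma: compare the first coefficients of both factors not divisible by the prime.\<close>

lemma prime_in_polys_over_const:
  assumes p: "prime_in D p"
  shows "prime_in (polys_over D) [:p:]"
  unfolding prime_in_def
proof (intro conjI ballI impI)
  have pD: "p \<in> D" "p \<noteq> 0" using p by (auto simp: prime_in_def)
  then show "[:p:] \<in> polys_over D" "[:p:] \<noteq> 0" by (auto intro: const_in_polys_over)
  show "\<not> unit_in (polys_over D) [:p:]"
  proof
    assume "unit_in (polys_over D) [:p:]"
    then obtain g where g: "g \<in> polys_over D" "1 = [:p:] * g" by (auto simp: unit_in_def dvd_in_def)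
    then have "coeff 1 0 = coeff ([:p:] * g) 0" by simp
    then have "1 = p * coeff g 0" by simp
    then have "unit_in D p" using pD polys_overD[OF g(1)] by (auto simp: unit_in_def dvd_in_def)
    then show False using p by (simp add: prime_in_def)
  qed
next
  fix f g assume f: "f \<in> polys_over D" and g: "g \<in> polys_over D"
    and dv: "dvd_in (polys_over D) [:p:] (f * g)"
  have pD: "p \<in> D" using p by (auto simp: prime_in_def)
  have dvc: "dvd_in D p (coeff (f * g) n)" for n
    using dv const_dvd_in_polys_over_iff[of "f * g" p] E.mult f g by blast
  show "dvd_in (polys_over D) [:p:] f \<or> dvd_in (polys_over D) [:p:] g"
  proof (rule ccontr)
    assume neg: "\<not> ?thesis"
    then have ex: "\<exists>i. \<not> dvd_in D p (coeff f i)" "\<exists>j. \<not> dvd_in D p (coeff g j)"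
      using const_dvd_in_polys_over_iff f g by auto
    define i where "i = (LEAST i. \<not> dvd_in D p (coeff f i))"
    define j where "j = (LEAST j. \<not> dvd_in D p (coeff g j))"
    have i: "\<not> dvd_in D p (coeff f i)" "\<And>k. k < i \<Longrightarrow> dvd_in D p (coeff f k)"
      unfolding i_def using LeastI_ex[OF ex(1)] not_less_Least by blast+
    have j: "\<not> dvd_in D p (coeff g j)" "\<And>k. k < j \<Longrightarrow> dvd_in D p (coeff g k)"
      unfolding j_def using LeastI_ex[OF ex(2)] not_less_Least by blast+
    have "coeff (f * g) (i + j) = (\<Sum>k\<le>i + j. coeff f k * coeff g (i + j - k))"
      by (rule coeff_mult)
    also have "\<dots> = coeff f i * coeff g j +
        (\<Sum>k\<in>{..i + j} - {i}. coeff f k * coeff g (i + j - k))"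
      by (subst sum.remove[of _ i]) auto
    finally have eq: "coeff f i * coeff g j = coeff (f * g) (i + j) -
        (\<Sum>k\<in>{..i + j} - {i}. coeff f k * coeff g (i + j - k))" by simp
    have "dvd_in D p (\<Sum>k\<in>{..i + j} - {i}. coeff f k * coeff g (i + j - k))"
    proof (rule dvd_in_sum)
      fix k assume "k \<in> {..i + j} - {i}"
      then consider "k < i" | "i + j - k < j" by force
      then show "dvd_in D p (coeff f k * coeff g (i + j - k))"
        by cases (use i j polys_overD f g in \<open>auto intro: dvd_in_mult dvd_in_mult_left\<close>)
    qed
    then have "dvd_in D p (coeff f i * coeff g j)"
      unfolding eq using dvc by (intro dvd_in_diff)
    then show False using p i j polys_overD f g unfolding prime_in_def by blast
  qed
qed

lemma unit_in_polys_over_const: "unit_in D u \<Longrightarrow> unit_in (polys_over D) [:u:]"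
  unfolding unit_in_def dvd_in_def using const_in_polys_over
  by (auto simp: one_pCons intro!: bexI[of _ "[:_:]"])

lemma factors_in_polys_over_const: "factors_in D n a \<Longrightarrow> factors_in (polys_over D) n [:a:]"
proof (induction rule: factors_in.induct)
  case (unit u)
  then show ?case by (intro factors_in.unit unit_in_polys_over_const)
next
  case (prime p n a)
  then have "factors_in (polys_over D) (Suc n) ([:p:] * [:a:])"
    by (intro factors_in.prime prime_in_polys_over_const)
  then show ?case by (simp add: mult.commute)
qed

text \<open>The primes of \<open>a\<close> are removed one at a time: each divides the product
  \<open>f * w\<close>, does not divide the prime-free \<open>f\<close>, hence divides
  \<open>w\<close> by Gauss's lemma and cancels.\<close>

lemma prime_free_dvd_smult_cancel:
  assumes "factors_in D n a" "prime_free D f" "f \<in> polys_over D" "h \<in> polys_over D"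
    "dvd_in (polys_over D) f (smult a h)"
  shows "dvd_in (polys_over D) f h"
  using assms
proof (induction rule: factors_in.induct)
  case (unit u)
  then obtain v where v: "v \<in> D" "1 = u * v" by (auto simp: unit_in_def dvd_in_def)
  have "dvd_in (polys_over D) f ([:v:] * smult u h)"
    using unit v by (intro E.dvd_in_mult_left const_in_polys_over)
  also have "[:v:] * smult u h = h" using v by (simp add: mult.commute)
  finally show ?case .
next
  case (prime p n a)
  have pD: "p \<in> D" "p \<noteq> 0" using prime by (auto simp: prime_in_def)
  have aD: "a \<in> D" using factors_in_closed prime by blast
  from prime obtain w where w: "w \<in> polys_over D" "smult (p * a) h = f * w"
    unfolding dvd_in_def by blast
  have eq: "[:p:] * smult a h = f * w" using w by (simp add: mult.commute)
  have "dvd_in (polys_over D) [:p:] (f * w)"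
    unfolding dvd_in_def eq[symmetric] using smult_in_polys_over aD prime by blast
  then have "dvd_in (polys_over D) [:p:] f \<or> dvd_in (polys_over D) [:p:] w"
    using prime_in_polys_over_const[OF prime(1)] prime w unfolding prime_in_def by blast
  moreover have "\<not> dvd_in (polys_over D) [:p:] f"
    using prime const_dvd_in_polys_over_iff unfolding prime_free_def by blast
  ultimately obtain w' where w': "w' \<in> polys_over D" "w = [:p:] * w'" unfolding dvd_in_def by blast
  have "smult p (smult a h) = smult p (f * w')" using eq w' by (simp add: mult.commute)
  then have "smult a h = f * w'"
    using smult_cancel_polys_over[OF pD] smult_in_polys_over[OF aD] E.mult prime w' by blast
  then show ?case using prime w' unfolding dvd_in_def by blast
qed

end

section \<open>Unique factorization passes to polynomials in one variable\<close>

locale factorial_subdomain = subdomain +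
  assumes factorization: "a \<in> D \<Longrightarrow> a \<noteq> 0 \<Longrightarrow> \<exists>n. factors_in D n a"
begin

interpretation E: subdomain "polys_over D"
  by (rule subdomain_polys_over)

text \<open>Dividing out a prime common to all coefficients removes a prime from the leading
  coefficient, so the number of primes there bounds the number of steps.\<close>

lemma prime_free_part:
  assumes "f \<in> polys_over D" "f \<noteq> 0"
  shows "\<exists>s f'. s \<in> D \<and> s \<noteq> 0 \<and> f' \<in> polys_over D \<and> f' \<noteq> 0 \<and> prime_free D f' \<and> f = smult s f'"
proof -
  obtain n where "factors_in D n (lead_coeff f)"
    using factorization[of "lead_coeff f"] assms polys_overD by auto
  then show ?thesis using assms
  proof (induction n arbitrary: f rule: less_induct)
    case (less n)
    show ?case
    proof (cases "prime_free D f")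
      case True
      then show ?thesis using less.prems one one_neq_zero smult_1_left by metis
    next
      case False
      then obtain p where p: "prime_in D p" "\<forall>n. dvd_in D p (coeff f n)"
        unfolding prime_free_def by blast
      then have "dvd_in (polys_over D) [:p:] f" using const_dvd_in_polys_over_iff less by blast
      then obtain g where g: "g \<in> polys_over D" "f = smult p g" by (auto simp: dvd_in_def)
      have pD: "p \<in> D" "p \<noteq> 0" using p by (auto simp: prime_in_def)
      have g0: "g \<noteq> 0" using g less.prems by auto
      have "degree f = degree g"
        using nonzero_degree_mult_polys_over(2)[of "[:p:]" g] pD g g0 const_in_polys_over by simp
      then have "lead_coeff f = p * lead_coeff g" unfolding g(2) by simp
      then obtain n' where n': "n' < n" "factors_in D n' (lead_coeff g)"
        using factors_in_prime_div[OF less.prems(1) p(1) _ polys_overD[OF g(1)]] by blast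
      then obtain s f' where sf: "s \<in> D \<and> s \<noteq> 0 \<and> f' \<in> polys_over D \<and> f' \<noteq> 0 \<and> prime_free D f' \<and> g = smult s f'"
        using less.IH[OF n' g(1) g0] by blast
      moreover have "p * s \<noteq> 0" using no_zero_divisors pD sf by blast
      moreover have "p * s \<in> D" using mult pD sf by blast
      moreover have "f = smult (p * s) f'"
      proof -
        from sf have "g = smult s f'" by blast
        then show ?thesis unfolding g(2) by simp
      qed
      ultimately show ?thesis by blast
    qed
  qed
qed

text \<open>
  The common divisor is the primitive part of an element of least degree in the ideal generated by
  the two polynomials; pseudo-division shows that it divides all elements of the ideal.
\<close>

lemma common_divisor:
  assumes f: "f \<in> polys_over D" "f \<noteq> 0" and g: "g \<in> polys_over D"
  shows "\<exists>s u A B. s \<in> D \<and> s \<noteq> 0 \<and> u \<in> polys_over D \<and> u \<noteq> 0 \<and> prime_free D u \<and>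
    dvd_in (polys_over D) u f \<and> dvd_in (polys_over D) u g \<and>
    A \<in> polys_over D \<and> B \<in> polys_over D \<and> smult s u = A * f + B * g"
proof -
  define I where "I = {A * f + B * g | A B. A \<in> polys_over D \<and> B \<in> polys_over D}"
  have fI: "f \<in> I" unfolding I_def
    by (rule CollectI, rule exI[of _ 1], rule exI[of _ 0]) simp
  have gI: "g \<in> I" unfolding I_def
    by (rule CollectI, rule exI[of _ 0], rule exI[of _ 1]) simp
  have I_E: "I \<subseteq> polys_over D" unfolding I_def using f g E.add E.mult by blast
  have I_diff: "h - k \<in> I" if hk: "h \<in> I" "k \<in> I" for h k
  proof -
    from hk obtain A B A' B' where "A \<in> polys_over D" "B \<in> polys_over D" "h = A * f + B * g"
      "A' \<in> polys_over D" "B' \<in> polys_over D" "k = A' * f + B' * g" unfolding I_def by blast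
    then have "h - k = (A - A') * f + (B - B') * g" "A - A' \<in> polys_over D" "B - B' \<in> polys_over D"
      by (auto simp: algebra_simps intro: E.diff)
    then show ?thesis unfolding I_def by blast
  qed
  have I_mult: "c * h \<in> I" if ch: "h \<in> I" "c \<in> polys_over D" for h c
  proof -
    from ch obtain A B where "A \<in> polys_over D" "B \<in> polys_over D" "h = A * f + B * g"
      unfolding I_def by blast
    then have "c * h = (c * A) * f + (c * B) * g" "c * A \<in> polys_over D" "c * B \<in> polys_over D"
      using ch by (auto simp: algebra_simps intro: E.mult)
    then show ?thesis unfolding I_def by blast
  qed
  obtain v where v: "v \<in> I" "v \<noteq> 0" and vmin: "\<And>h. h \<in> I \<Longrightarrow> h \<noteq> 0 \<Longrightarrow> degree v \<le> degree h"
    using ex_has_least_nat[of "\<lambda>h. h \<in> I \<and> h \<noteq> 0" f degree] fI f by blast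
  have vE: "v \<in> polys_over D" using v I_E by blast
  then obtain s u where u: "s \<in> D" "s \<noteq> 0" "u \<in> polys_over D" "u \<noteq> 0" "prime_free D u" "v = smult s u"
    using prime_free_part v by blast
  have pseudo: "\<exists>a\<in>D. a \<noteq> 0 \<and> dvd_in (polys_over D) v (smult a h)" if "h \<in> I" for h
    using that
  proof (induction "degree h" arbitrary: h rule: less_induct)
    case less
    let ?l = "lead_coeff v"
    have l: "?l \<in> D" "?l \<noteq> 0" using vE v polys_overD by auto
    show ?case
    proof (cases "h = 0")
      case True
      then show ?thesis using E.dvd_in_0 one by (intro bexI[of _ 1]) auto
    next
      case False
      then have deg: "degree v \<le> degree h" using vmin less.prems by blast
      define m where "m = monom (lead_coeff h) (degree h - degree v)"
      have hE: "h \<in> polys_over D" using less.prems I_E by blast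
      have mE: "m \<in> polys_over D" unfolding m_def using hE polys_overD
        by (intro monom_in_polys_over) auto
      \<comment> \<open>Multiplying \<open>h\<close> by the leading coefficient of \<open>v\<close>
        replaces a division that may not be possible in \<open>D\<close>: the top coefficients of
        both terms agree and cancel.\<close>
      define k where "k = smult ?l h - m * v"
      have "[:?l:] * h - m * v \<in> I"
        using I_diff I_mult less.prems v mE const_in_polys_over[OF l(1)] by blast
      then have kI: "k \<in> I" by (simp add: k_def)
      have mv: "coeff (m * v) (degree h) = lead_coeff h * ?l"
        using deg unfolding m_def by (simp add: coeff_monom_mult)
      have "degree (m * v) \<le> degree h"
        using degree_mult_le[of m v] degree_monom_le[of "lead_coeff h" "degree h - degree v"] deg
        unfolding m_def by linarith
      then have kdeg: "degree k \<le> degree h"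
        unfolding k_def by (intro degree_diff_le) (use degree_smult_le[of ?l h] in auto)
      have kc: "coeff k (degree h) = 0" unfolding k_def using mv by (simp add: mult.commute)
      have "\<exists>a\<in>D. a \<noteq> 0 \<and> dvd_in (polys_over D) v (smult a k)"
      proof (cases "degree k < degree h")
        case True
        then show ?thesis using less.hyps kI by blast
      next
        \<comment> \<open>The coefficient of \<open>k\<close> at \<open>degree h\<close> is zero, so
          equal degrees leave only \<open>k = 0\<close>; this happens when \<open>h\<close> is
          constant.\<close>
        case False
        then have "degree k = degree h" using kdeg by simp
        then have "lead_coeff k = 0" using kc by simp
        then show ?thesis using E.dvd_in_0 one by (intro bexI[of _ 1]) auto
      qed
      then obtain a where a: "a \<in> D" "a \<noteq> 0" "dvd_in (polys_over D) v (smult a k)" by blast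
      have "dvd_in (polys_over D) v (smult a k + smult a m * v)"
        by (intro E.dvd_in_add a(3) E.dvd_in_mult_left E.dvd_in_refl smult_in_polys_over a(1) mE)
      also have "smult a k + smult a m * v = smult (a * ?l) h"
        unfolding k_def by (simp add: smult_diff_right)
      finally have "dvd_in (polys_over D) v (smult (a * ?l) h)" .
      moreover have "a * ?l \<noteq> 0" using no_zero_divisors a l by blast
      ultimately show ?thesis using mult a l by blast
    qed
  qed
  have dvd_I: "dvd_in (polys_over D) u h" if h: "h \<in> I" for h
  proof -
    obtain a where a: "a \<in> D" "a \<noteq> 0" "dvd_in (polys_over D) v (smult a h)" using pseudo[OF h] by blast
    have "dvd_in (polys_over D) u v" unfolding dvd_in_def
      using u const_in_polys_over[OF u(1)] by (intro bexI[of _ "[:s:]"]) auto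
    then have "dvd_in (polys_over D) u (smult a h)" using a E.dvd_in_trans by blast
    then show ?thesis
      using prime_free_dvd_smult_cancel factorization[OF a(1,2)] u h I_E by blast
  qed
  from v obtain A B where "A \<in> polys_over D" "B \<in> polys_over D" "v = A * f + B * g"
    unfolding I_def by blast
  then show ?thesis using u dvd_I fI gI by metis
qed

lemma prime_free_const_unit:
  assumes "c \<in> D" "c \<noteq> 0" "prime_free D [:c:]"
  shows "unit_in D c"
proof -
  obtain n where "factors_in D n c" using factorization assms by blast
  then show ?thesis
  proof cases
    case unit
    then show ?thesis by simp
  next
    case (prime p m a)
    then have "a \<in> D" using factors_in_closed by blast
    then have "dvd_in D p c" using prime(2) unfolding dvd_in_def by blast
    then have "\<forall>n. dvd_in D p (coeff [:c:] n)"
      by (auto simp: coeff_pCons dvd_in_0 split: nat.splits)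
    then show ?thesis using prime assms unfolding prime_free_def by blast
  qed
qed

lemma prime_free_dvd:
  assumes "prime_free D f" "f = g * h" "g \<in> polys_over D" "h \<in> polys_over D"
  shows "prime_free D g"
  unfolding prime_free_def
proof
  assume "\<exists>p. prime_in D p \<and> (\<forall>n. dvd_in D p (coeff g n))"
  then obtain p where p: "prime_in D p" "dvd_in (polys_over D) [:p:] g"
    using const_dvd_in_polys_over_iff assms by blast
  then have "dvd_in (polys_over D) [:p:] f" using assms E.dvd_in_mult by blast
  then show False
    using p assms const_dvd_in_polys_over_iff[of f] E.mult unfolding prime_free_def by blast
qed

text \<open>Induct on the degree and pass to the primitive part \<open>f'\<close>. If
  \<open>f'\<close> is neither constant nor prime, it divides some \<open>g * h\<close> without
  dividing \<open>g\<close> or \<open>h\<close>, and the common divisor \<open>u\<close> of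
  \<open>f'\<close> and \<open>g\<close> splits it properly: a constant cofactor would make
  \<open>f'\<close> divide \<open>g\<close>, and a constant \<open>u\<close> would make
  \<open>f'\<close> divide a constant multiple of \<open>h\<close>, hence \<open>h\<close>
  itself.\<close>

lemma factorial_subdomain_polys_over: "factorial_subdomain (polys_over D)"
proof
  fix f assume "f \<in> polys_over D" "f \<noteq> 0"
  then show "\<exists>n. factors_in (polys_over D) n f"
  proof (induction "degree f" arbitrary: f rule: less_induct)
    case less
    obtain s f' where f': "s \<in> D" "s \<noteq> 0" "f' \<in> polys_over D" "f' \<noteq> 0" "prime_free D f'" "f = smult s f'"
      using prime_free_part less.prems by blast
    have deg: "degree f = degree f'"
      using nonzero_degree_mult_polys_over(2)[of "[:s:]" f'] f' const_in_polys_over by simp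
    have "\<exists>n. factors_in (polys_over D) n f'"
    proof (cases "degree f' = 0 \<or> prime_in (polys_over D) f'")
      case True
      then show ?thesis
      proof
        assume "degree f' = 0"
        then obtain c where c: "f' = [:c:]" by (rule degree_eq_zeroE)
        then have "c \<in> D" "c \<noteq> 0" using f' polys_overD[of f' 0] by auto
        then have "unit_in (polys_over D) f'"
          using c f' prime_free_const_unit unit_in_polys_over_const by blast
        then show ?thesis using factors_in.unit by blast
      next
        assume "prime_in (polys_over D) f'"
        moreover have "factors_in (polys_over D) 0 1"
          using E.dvd_in_refl by (intro factors_in.unit) (auto simp: unit_in_def)
        ultimately have "factors_in (polys_over D) (Suc 0) (f' * 1)" by (rule factors_in.prime)
        then show ?thesis by auto
      qed
    next
      case False
      have "\<not> unit_in (polys_over D) f'"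
      proof
        assume "unit_in (polys_over D) f'"
        then obtain w where w: "w \<in> polys_over D" "1 = f' * w" by (auto simp: unit_in_def dvd_in_def)
        then have "w \<noteq> 0" by auto
        then have "degree (1 :: 'a poly) = degree f' + degree w"
          unfolding w(2) using nonzero_degree_mult_polys_over(2) f' w by blast
        then show False using False by simp
      qed
      then obtain g h where gh: "g \<in> polys_over D" "h \<in> polys_over D"
        "dvd_in (polys_over D) f' (g * h)"
        "\<not> dvd_in (polys_over D) f' g" "\<not> dvd_in (polys_over D) f' h"
        using False f' unfolding prime_in_def by blast
      obtain t u A B where u: "t \<in> D" "t \<noteq> 0" "u \<in> polys_over D" "u \<noteq> 0" "prime_free D u"
        "dvd_in (polys_over D) u f'" "dvd_in (polys_over D) u g"
        "A \<in> polys_over D" "B \<in> polys_over D" "smult t u = A * f' + B * g"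
        using common_divisor[OF f'(3,4) gh(1)] by blast
      obtain q where q: "q \<in> polys_over D" "f' = u * q" using u unfolding dvd_in_def by blast
      have "q \<noteq> 0" using q f' by auto
      have degs: "degree f' = degree u + degree q"
        using nonzero_degree_mult_polys_over(2) u q \<open>q \<noteq> 0\<close> by blast
      have "degree q \<noteq> 0"
      proof
        assume "degree q = 0"
        then obtain c where c: "q = [:c:]" by (rule degree_eq_zeroE)
        then have "c \<in> D" "c \<noteq> 0" using q polys_overD[of q 0] \<open>q \<noteq> 0\<close> by auto
        moreover have "prime_free D q" using prime_free_dvd[of f' q u] f' q u by (simp add: mult.commute)
        ultimately have "unit_in D c" using c prime_free_const_unit by blast
        then obtain d where d: "d \<in> D" "1 = c * d" by (auto simp: unit_in_def dvd_in_def)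
        have "u = f' * [:d:]" using q c d by (simp add: mult.commute)
        then have "dvd_in (polys_over D) f' u" using d const_in_polys_over unfolding dvd_in_def by blast
        then show False using gh u E.dvd_in_trans by blast
      qed
      moreover have "degree u \<noteq> 0"
      proof
        assume "degree u = 0"
        then obtain c where c: "u = [:c:]" by (rule degree_eq_zeroE)
        then have cD: "c \<in> D" "c \<noteq> 0" using u polys_overD[of u 0] by auto
        have "smult (t * c) h = (smult t u) * h" using c by simp
        also have "\<dots> = f' * (A * h) + B * (g * h)" unfolding u(10) by (simp add: algebra_simps)
        finally have "dvd_in (polys_over D) f' (smult (t * c) h)"
          using gh u f' E.dvd_in_mult E.dvd_in_refl E.mult E.dvd_in_mult_left
          by (metis E.dvd_in_add)
        moreover have "t * c \<noteq> 0" "t * c \<in> D" using no_zero_divisors u cD mult by blast+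
        ultimately have "dvd_in (polys_over D) f' h"
          using prime_free_dvd_smult_cancel factorization f' gh by blast
        then show False using gh by blast
      qed
      ultimately have "degree u < degree f" "degree q < degree f" using degs deg by auto
      then obtain n m where "factors_in (polys_over D) n u" "factors_in (polys_over D) m q"
        using less.hyps u q \<open>q \<noteq> 0\<close> by blast
      then show ?thesis using E.factors_in_mult q by blast
    qed
    moreover obtain m where "factors_in D m s" using factorization f' by blast
    ultimately show ?case
      using E.factors_in_mult[OF factors_in_polys_over_const] f' by fastforce
  qed
qed

end

text \<open>Meant for evaluation at a coordinate function, which is injective on the carrier of
  interest but not on all polynomials over the function ring.\<close>

lemma factorial_subdomain_image:
  fixes \<phi> :: "'r::comm_ring_1 \<Rightarrow> 's::comm_ring_1"
  assumes "factorial_subdomain D" "inj_on \<phi> D" "\<phi> 1 = 1"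
    and diff: "\<And>a b. a \<in> D \<Longrightarrow> b \<in> D \<Longrightarrow> \<phi> (a - b) = \<phi> a - \<phi> b"
    and mult: "\<And>a b. a \<in> D \<Longrightarrow> b \<in> D \<Longrightarrow> \<phi> (a * b) = \<phi> a * \<phi> b"
  shows "factorial_subdomain (\<phi> ` D)"
proof -
  interpret D: factorial_subdomain D by fact
  have z: "\<phi> 0 = 0" using diff[of 1 1] by simp
  have z_iff: "\<phi> a = 0 \<longleftrightarrow> a = 0" if "a \<in> D" for a
    using that z \<open>inj_on \<phi> D\<close> D.zero by (metis inj_onD)
  have dvd_iff: "dvd_in (\<phi> ` D) (\<phi> a) (\<phi> b) \<longleftrightarrow> dvd_in D a b" if "a \<in> D" "b \<in> D" for a b
    unfolding dvd_in_def using that mult \<open>inj_on \<phi> D\<close> D.mult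
    by (auto simp: inj_on_eq_iff) (metis inj_onD)
  have unit_iff: "unit_in (\<phi> ` D) (\<phi> a) \<longleftrightarrow> unit_in D a" if "a \<in> D" for a
    unfolding unit_in_def using that dvd_iff[of a 1] \<open>\<phi> 1 = 1\<close> by simp
  have p_prime: "prime_in (\<phi> ` D) (\<phi> p)" if "prime_in D p" for p
    using that unfolding prime_in_def
    by (auto simp: unit_iff z_iff mult[symmetric] dvd_iff D.mult)
  have factors: "factors_in (\<phi> ` D) n (\<phi> a)" if "factors_in D n a" for n a
    using that
  proof (induction rule: factors_in.induct)
    case (unit u)
    then show ?case by (intro factors_in.unit) (auto simp: unit_iff unit_in_def[of D])
  next
    case (prime p n a)
    then have "\<phi> (p * a) = \<phi> p * \<phi> a"
      using D.factors_in_closed by (intro mult) (auto simp: prime_in_def)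
    then show ?case using prime assms by (auto simp: p_prime intro!: factors_in.prime)
  qed
  show ?thesis
  proof
    show "1 \<in> \<phi> ` D" using D.one \<open>\<phi> 1 = 1\<close> by (metis image_eqI)
  next
    fix a b assume "a \<in> \<phi> ` D" "b \<in> \<phi> ` D"
    then obtain x y where xy: "x \<in> D" "y \<in> D" "a = \<phi> x" "b = \<phi> y" by blast
    then show "a - b \<in> \<phi> ` D" "a * b \<in> \<phi> ` D"
      using diff mult D.diff D.mult by (metis image_eqI)+
    assume "a * b = 0"
    then have "x * y = 0" using xy mult z_iff D.mult by metis
    then show "a = 0 \<or> b = 0" using xy z D.no_zero_divisors by blast
  next
    fix a assume "a \<in> \<phi> ` D" "a \<noteq> 0"
    then show "\<exists>n. factors_in (\<phi> ` D) n a" using factors D.factorization z by blast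
  qed
qed

section \<open>Rings of polynomial functions\<close>

text \<open>The map \<open>h\<close> separates where points live from where values live:
  \<open>to_fract\<close> gives polynomials over the fraction field evaluated at integral points,
  \<open>id\<close> gives integral polynomials. \<open>S\<close> is the set of variables that may
  occur.\<close>

inductive_set poly_funs :: "('b \<Rightarrow> 'k::comm_ring_1) \<Rightarrow> 'n set \<Rightarrow> (('n \<Rightarrow> 'b) \<Rightarrow> 'k) set"
  for h :: "'b \<Rightarrow> 'k" and S :: "'n set"
  where
    const: "(\<lambda>_. a) \<in> poly_funs h S"
  | var: "i \<in> S \<Longrightarrow> (\<lambda>c. h (c i)) \<in> poly_funs h S"
  | add: "f \<in> poly_funs h S \<Longrightarrow> g \<in> poly_funs h S \<Longrightarrow> (\<lambda>c. f c + g c) \<in> poly_funs h S"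
  | mult: "f \<in> poly_funs h S \<Longrightarrow> g \<in> poly_funs h S \<Longrightarrow> (\<lambda>c. f c * g c) \<in> poly_funs h S"

lemma poly_funs_compose:
  assumes "f \<in> poly_funs h S" "\<And>i. i \<in> S \<Longrightarrow> (\<lambda>c. h (\<sigma> c i)) \<in> poly_funs h S'"
  shows "(\<lambda>c. f (\<sigma> c)) \<in> poly_funs h S'"
  using assms by (induction rule: poly_funs.induct) (auto intro: poly_funs.intros)

lemma poly_funs_mono: "f \<in> poly_funs h S \<Longrightarrow> S \<subseteq> S' \<Longrightarrow> f \<in> poly_funs h S'"
  by (induction rule: poly_funs.induct) (auto intro: poly_funs.intros)

lemma poly_funs_cong:
  "f \<in> poly_funs h S \<Longrightarrow> (\<And>i. i \<in> S \<Longrightarrow> c i = c' i) \<Longrightarrow> f c = f c'"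
  by (induction rule: poly_funs.induct) auto

lemma poly_funs_sum:
  "(\<And>j. j \<in> J \<Longrightarrow> f j \<in> poly_funs h S) \<Longrightarrow> (\<lambda>c. \<Sum>j\<in>J. f j c) \<in> poly_funs h S"
  by (induction J rule: infinite_finite_induct) (auto intro: poly_funs.intros)

lemma poly_funs_prod:
  "(\<And>j. j \<in> J \<Longrightarrow> f j \<in> poly_funs h S) \<Longrightarrow> (\<lambda>c. \<Prod>j\<in>J. f j c) \<in> poly_funs h S"
  by (induction J rule: infinite_finite_induct) (auto intro: poly_funs.intros)

lemma poly_funs_power: "f \<in> poly_funs h S \<Longrightarrow> (\<lambda>c. f c ^ n) \<in> poly_funs h S"
  by (induction n) (auto intro: poly_funs.intros)

lemma poly_funs_diff:
  assumes "f \<in> poly_funs h S" "g \<in> poly_funs h S"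
  shows "(\<lambda>c. f c - g c) \<in> poly_funs h S"
  using poly_funs.add[OF assms(1) poly_funs.mult[OF poly_funs.const[of "-1"] assms(2)]] by simp

lemma sum_fun_apply: "(\<Sum>j\<in>J. f j) c = (\<Sum>j\<in>J. f j c)"
  by (induction J rule: infinite_finite_induct) auto

lemma poly_apply:
  fixes p :: "('c \<Rightarrow> 'k::comm_ring_1) poly"
  shows "poly p x c = poly (map_poly (\<lambda>f. f c) p) (x c)"
  by (induction p) (auto simp: map_poly_pCons)

text \<open>Fix \<open>c\<close> and vary only coordinate \<open>i\<close>. The coefficients do not
  see the change, so one univariate polynomial vanishes at every \<open>h y\<close>, that is, at
  infinitely many points.\<close>

lemma poly_funs_transcendental:
  fixes h :: "'b \<Rightarrow> 'k::idom" and p :: "(('n \<Rightarrow> 'b) \<Rightarrow> 'k) poly"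
  assumes "infinite (range h)" "i \<notin> S" "p \<in> polys_over (poly_funs h S)"
    and eq0: "poly p (\<lambda>c. h (c i)) = 0"
  shows "p = 0"
proof (rule poly_eqI, rule ext)
  fix n c
  let ?q = "map_poly (\<lambda>f. f c) p"
  have "poly ?q (h y) = 0" for y
  proof -
    have "coeff p k (c(i := y)) = coeff p k c" for k
      using assms by (intro poly_funs_cong[of _ h S]) (auto simp: polys_over_def)
    then have "map_poly (\<lambda>f. f (c(i := y))) p = ?q"
      by (intro poly_eqI) (simp add: coeff_map_poly)
    then show ?thesis
      using poly_apply[of p "\<lambda>c. h (c i)" "c(i := y)"] eq0 by simp
  qed
  then have "range h \<subseteq> {x. poly ?q x = 0}" by auto
  then have "?q = 0" using assms(1) poly_roots_finite finite_subset by blast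
  then have "coeff ?q n = 0" by simp
  then show "coeff p n c = coeff 0 n c" by (simp add: coeff_map_poly)
qed

text \<open>The passage to one more variable: functions become univariate polynomials over the
  previous ring, where Gauss's lemma is available.\<close>

lemma poly_funs_insert:
  fixes h :: "'b \<Rightarrow> 'k::comm_ring_1"
  shows "poly_funs h (insert i S) = (\<lambda>p. poly p (\<lambda>c. h (c i))) ` polys_over (poly_funs h S)"
proof (intro subset_antisym subsetI)
  fix f assume "f \<in> poly_funs h (insert i S)"
  then show "f \<in> (\<lambda>p. poly p (\<lambda>c. h (c i))) ` polys_over (poly_funs h S)"
  proof (induction rule: poly_funs.induct)
    case (const a)
    have "[:\<lambda>_. a:] \<in> polys_over (poly_funs h S)"
      using poly_funs.const[of 0 h S]
      by (auto simp: polys_over_def coeff_pCons zero_fun_def intro: poly_funs.const split: nat.splits)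
    then show ?case by (rule rev_image_eqI) simp
  next
    case (var j)
    show ?case
    proof (cases "j = i")
      case True
      have "[:0, 1:] \<in> polys_over (poly_funs h S)"
        using poly_funs.const[of 0 h S] poly_funs.const[of 1 h S]
        by (auto simp: polys_over_def coeff_pCons zero_fun_def one_fun_def split: nat.splits)
      then show ?thesis using True by (intro rev_image_eqI) auto
    next
      case False
      then have "[:\<lambda>c. h (c j):] \<in> polys_over (poly_funs h S)"
        using poly_funs.const[of 0 h S] var
        by (auto simp: polys_over_def coeff_pCons zero_fun_def intro: poly_funs.var split: nat.splits)
      then show ?thesis by (rule rev_image_eqI) simp
    qed
  next
    case (add f g)
    then obtain p q where "p \<in> polys_over (poly_funs h S)" "q \<in> polys_over (poly_funs h S)"
      "f = poly p (\<lambda>c. h (c i))" "g = poly q (\<lambda>c. h (c i))" by blast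
    then show ?case
      by (intro image_eqI[of _ _ "p + q"])
        (auto simp: polys_over_def plus_fun_def intro: poly_funs.add)
  next
    case (mult f g)
    then obtain p q where "p \<in> polys_over (poly_funs h S)" "q \<in> polys_over (poly_funs h S)"
      "f = poly p (\<lambda>c. h (c i))" "g = poly q (\<lambda>c. h (c i))" by blast
    moreover have "coeff (p * q) n \<in> poly_funs h S" for n
    proof -
      have "(\<lambda>c. \<Sum>k\<le>n. coeff p k c * coeff q (n - k) c) \<in> poly_funs h S"
        using calculation by (intro poly_funs_sum poly_funs.mult) (auto simp: polys_over_def)
      moreover have "coeff (p * q) n = (\<lambda>c. \<Sum>k\<le>n. coeff p k c * coeff q (n - k) c)"
        by (rule ext) (simp add: coeff_mult sum_fun_apply)
      ultimately show ?thesis by simp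
    qed
    ultimately show ?case
      by (intro image_eqI[of _ _ "p * q"]) (auto simp: polys_over_def times_fun_def)
  qed
next
  fix f assume "f \<in> (\<lambda>p. poly p (\<lambda>c. h (c i))) ` polys_over (poly_funs h S)"
  then obtain p where p: "f = poly p (\<lambda>c. h (c i))" "p \<in> polys_over (poly_funs h S)" by blast
  have "coeff p k \<in> poly_funs h (insert i S)" for k
    using p(2) by (auto simp: polys_over_def intro: poly_funs_mono[of _ h S "insert i S"])
  then have "poly p (\<lambda>c. h (c i)) \<in> poly_funs h (insert i S)"
  proof (induction p)
    case 0
    then show ?case using poly_funs.const[of 0] by (simp add: zero_fun_def)
  next
    case (pCons a p)
    have "a \<in> poly_funs h (insert i S)" using pCons.prems[of 0] by simp
    moreover have "poly p (\<lambda>c. h (c i)) \<in> poly_funs h (insert i S)"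
      using pCons.prems[of "Suc _"] by (intro pCons.IH) simp
    moreover have "poly (pCons a p) (\<lambda>c. h (c i)) = (\<lambda>c. a c + h (c i) * poly p (\<lambda>c. h (c i)) c)"
      by (rule ext) simp
    ultimately show ?case
      by (auto intro!: poly_funs.add poly_funs.mult poly_funs.var)
  qed
  then show "f \<in> poly_funs h (insert i S)" using p by simp
qed

lemma poly_funs_empty: "poly_funs h {} = range (\<lambda>a _. a)"
proof (intro subset_antisym subsetI)
  fix f assume "f \<in> poly_funs h {}"
  then show "f \<in> range (\<lambda>a _. a)"
    by (induction rule: poly_funs.induct) auto
qed (auto intro: poly_funs.const)

text \<open>The variables are adjoined one at a time. Without variables only constants remain, and
  the nonzero ones are units because the values lie in a field; each further variable is
  transcendental because \<open>h\<close> has infinite range.\<close>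

lemma factorial_subdomain_poly_funs:
  fixes h :: "'b \<Rightarrow> 'k::field" and S :: "'n set"
  assumes "infinite (range h)" "finite S"
  shows "factorial_subdomain (poly_funs h S)"
  using assms(2)
proof (induction S rule: finite_induct)
  case empty
  show ?case
  proof
    show "1 \<in> poly_funs h {}" using poly_funs.const[of 1] by (simp add: one_fun_def)
  next
    fix f g :: "('n \<Rightarrow> 'b) \<Rightarrow> 'k" assume "f \<in> poly_funs h {}" "g \<in> poly_funs h {}"
    then obtain a b where ab: "f = (\<lambda>_. a)" "g = (\<lambda>_. b)" by (auto simp: poly_funs_empty)
    then show "f - g \<in> poly_funs h {}" "f * g \<in> poly_funs h {}" "f * g = 0 \<Longrightarrow> f = 0 \<or> g = 0"
      by (auto simp: fun_eq_iff fun_diff_def times_fun_def intro: poly_funs.const)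
  next
    fix f :: "('n \<Rightarrow> 'b) \<Rightarrow> 'k" assume "f \<in> poly_funs h {}" "f \<noteq> 0"
    then obtain a where a: "f = (\<lambda>_. a)" "a \<noteq> 0" by (auto simp: poly_funs_empty zero_fun_def)
    then have "1 = f * (\<lambda>_. inverse a)" by (simp add: fun_eq_iff)
    then have "unit_in (poly_funs h {}) f"
      using poly_funs.const unfolding unit_in_def dvd_in_def a(1) by blast
    then show "\<exists>n. factors_in (poly_funs h {}) n f" by (blast intro: factors_in.unit)
  qed
next
  case (insert i S)
  interpret D: factorial_subdomain "poly_funs h S" by fact
  have fs: "factorial_subdomain (polys_over (poly_funs h S))"
    by (rule D.factorial_subdomain_polys_over)
  interpret E: factorial_subdomain "polys_over (poly_funs h S)" by fact
  show ?case unfolding poly_funs_insert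
  proof (rule factorial_subdomain_image[OF fs])
    show "inj_on (\<lambda>p. poly p (\<lambda>c. h (c i))) (polys_over (poly_funs h S))"
    proof (rule inj_onI)
      fix p q assume "p \<in> polys_over (poly_funs h S)" "q \<in> polys_over (poly_funs h S)"
        "poly p (\<lambda>c. h (c i)) = poly q (\<lambda>c. h (c i))"
      then have "p - q = 0"
        using insert assms(1) by (intro poly_funs_transcendental[of h i S]) (auto intro: E.diff)
      then show "p = q" by simp
    qed
  qed auto
qed

text \<open>View both polynomials in one variable over the others.\<close>

lemma poly_funs_elimination:
  fixes h :: "'b \<Rightarrow> 'k::field" and i :: "'n::finite"
  assumes inf: "infinite (range h)"
    and f: "f \<in> poly_funs h UNIV" "f \<noteq> 0" and g: "g \<in> poly_funs h UNIV"
    and cop: "\<And>d. d \<in> poly_funs h UNIV \<Longrightarrow> dvd_in (poly_funs h UNIV) d f \<Longrightarrow>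
      dvd_in (poly_funs h UNIV) d g \<Longrightarrow> unit_in (poly_funs h UNIV) d"
  shows "\<exists>s A B. s \<in> poly_funs h (UNIV - {i}) \<and> s \<noteq> 0 \<and>
    A \<in> poly_funs h UNIV \<and> B \<in> poly_funs h UNIV \<and> s = A * f + B * g"
proof -
  let ?D = "poly_funs h (UNIV - {i})"
  let ?\<phi> = "\<lambda>p. poly p (\<lambda>c. h (c i))"
  interpret D: factorial_subdomain ?D
    using inf by (intro factorial_subdomain_poly_funs) auto
  have "insert i (UNIV - {i}) = UNIV" by auto
  then have U: "poly_funs h UNIV = ?\<phi> ` polys_over ?D"
    using poly_funs_insert[of h i "UNIV - {i}"] by simp
  have inj: "p = 0" if "p \<in> polys_over ?D" "?\<phi> p = 0" for p
    using poly_funs_transcendental[OF inf, of i "UNIV - {i}" p] that by blast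
  interpret E: subdomain "polys_over ?D" by (rule D.subdomain_polys_over)
  obtain F G where FG: "F \<in> polys_over ?D" "G \<in> polys_over ?D" "f = ?\<phi> F" "g = ?\<phi> G"
    using f g U by blast
  have F0: "F \<noteq> 0" using FG f by auto
  obtain s u A B where u: "s \<in> ?D" "s \<noteq> 0" "u \<in> polys_over ?D" "u \<noteq> 0"
    "dvd_in (polys_over ?D) u F" "dvd_in (polys_over ?D) u G"
    "A \<in> polys_over ?D" "B \<in> polys_over ?D" "smult s u = A * F + B * G"
    using D.common_divisor[OF FG(1) F0 FG(2)] by blast
  have dvd: "dvd_in (poly_funs h UNIV) (?\<phi> p) (?\<phi> q)" if "dvd_in (polys_over ?D) p q" for p q
    using that unfolding U dvd_in_def by force
  \<comment> \<open>Coprimality turns the common divisor \<open>u\<close> into a unit, hence into a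
    constant \<open>c\<close> with respect to the variable \<open>i\<close>; the combination
    \<open>s * c\<close> is then free of that variable.\<close>
  have "unit_in (poly_funs h UNIV) (?\<phi> u)"
    using cop[of "?\<phi> u"] dvd[OF u(5)] dvd[OF u(6)] u(3) FG U by blast
  then obtain w where w: "w \<in> polys_over ?D" "1 = ?\<phi> u * ?\<phi> w"
    unfolding unit_in_def dvd_in_def U by blast
  have "?\<phi> (u * w - 1) = 0" using w by simp
  then have uw: "u * w = 1" using inj[of "u * w - 1"] E.diff E.mult u w E.one by fastforce
  then have "w \<noteq> 0" by auto
  then have "degree u = 0"
    using D.nonzero_degree_mult_polys_over(2)[of u w] u w uw by simp
  then obtain c where c: "u = [:c:]" by (rule degree_eq_zeroE)
  then have cD: "c \<in> ?D" "c \<noteq> 0" using u D.polys_overD[of u 0] by auto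
  have "s * c = ?\<phi> (smult s u)" unfolding c by simp
  also have "\<dots> = ?\<phi> A * f + ?\<phi> B * g" unfolding u(9) FG by simp
  finally have "s * c = ?\<phi> A * f + ?\<phi> B * g" .
  moreover have "s * c \<in> ?D" "s * c \<noteq> 0"
    using D.mult D.no_zero_divisors u cD by blast+
  moreover have "?\<phi> A \<in> poly_funs h UNIV" "?\<phi> B \<in> poly_funs h UNIV" using U u by blast+
  ultimately show ?thesis by blast
qed

text \<open>Induct on the variables. With all but variable \<open>i\<close> fixed, the sum is a
  polynomial in that variable vanishing on the infinite set \<open>X\<close>, so its coefficients
  vanish. The one at \<open>e m i\<close> is the sum over \<open>M'\<close>, where the remaining
  variables still separate the monomials.\<close>

lemma monomials_independent:
  fixes a :: "'m \<Rightarrow> 'k::idom" and e :: "'m \<Rightarrow> 'n \<Rightarrow> nat"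
  assumes "infinite X" "finite A" "finite M"
    and "\<And>m m'. m \<in> M \<Longrightarrow> m' \<in> M \<Longrightarrow> (\<forall>i\<in>A. e m i = e m' i) \<Longrightarrow> m = m'"
    and "\<And>c. (\<And>i. c i \<in> X) \<Longrightarrow> (\<Sum>m\<in>M. a m * (\<Prod>i\<in>A. c i ^ e m i)) = 0"
    and "m \<in> M"
  shows "a m = 0"
  using assms(2-)
proof (induction A arbitrary: M m rule: finite_induct)
  case empty
  have "M = {m}" using empty by blast
  moreover obtain x where "x \<in> X" using assms(1) by fastforce
  ultimately show ?case using empty(3)[of "\<lambda>_. x"] by simp
next
  case (insert i A)
  define M' where "M' = {m' \<in> M. e m' i = e m i}"
  have "(\<Sum>m\<in>M'. a m * (\<Prod>i\<in>A. c i ^ e m i)) = 0" if c: "\<And>j. c j \<in> X" for c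
  proof -
    define p where "p = (\<Sum>m\<in>M. monom (a m * (\<Prod>i\<in>A. c i ^ e m i)) (e m i))"
    have "poly p x = 0" if "x \<in> X" for x
    proof -
      have "poly p x = (\<Sum>m\<in>M. a m * (\<Prod>j\<in>insert i A. (c(i := x)) j ^ e m j))"
        unfolding p_def poly_sum
      proof (rule sum.cong)
        fix m
        have "(\<Prod>j\<in>A. (c(i := x)) j ^ e m j) = (\<Prod>j\<in>A. c j ^ e m j)"
          using insert.hyps by (intro prod.cong) auto
        then show "poly (monom (a m * (\<Prod>i\<in>A. c i ^ e m i)) (e m i)) x =
            a m * (\<Prod>j\<in>insert i A. (c(i := x)) j ^ e m j)"
          using insert.hyps by (simp add: poly_monom mult_ac)
      qed simp
      also have "\<dots> = 0" using c that by (intro insert.prems(3)) auto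
      finally show ?thesis .
    qed
    then have "X \<subseteq> {x. poly p x = 0}" by auto
    then have "p = 0" using assms(1) poly_roots_finite finite_subset by blast
    then have "0 = coeff p (e m i)" by simp
    also have "\<dots> = (\<Sum>m'\<in>M. if e m' i = e m i then a m' * (\<Prod>i\<in>A. c i ^ e m' i) else 0)"
      unfolding p_def coeff_sum by simp
    also have "\<dots> = (\<Sum>m\<in>M'. a m * (\<Prod>i\<in>A. c i ^ e m i))"
      unfolding M'_def using insert.prems(1) by (simp add: sum.If_cases Int_def)
    finally show ?thesis by simp
  qed
  moreover have "finite M'" "m \<in> M'" unfolding M'_def using insert.prems by auto
  moreover have "m1 = m2" if "m1 \<in> M'" "m2 \<in> M'" "\<forall>i\<in>A. e m1 i = e m2 i" for m1 m2
    using that insert.prems(2)[of m1 m2] unfolding M'_def by auto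
  ultimately show ?case using insert.IH[of M' m] by blast
qed

section \<open>Formal multivariate polynomials and their values\<close>

lemma mpoly_eval_superset:
  assumes "finite M" "Poly_Mapping.keys H \<subseteq> M"
  shows "mpoly_eval H c =
    (\<Sum>m\<in>M. Poly_Mapping.lookup H m * (\<Prod>i\<in>UNIV. c i ^ Poly_Mapping.lookup m i))"
  unfolding mpoly_eval_def
  by (rule sum.mono_neutral_left) (use assms in \<open>auto simp: in_keys_iff\<close>)

lemma mpoly_eval_add: "mpoly_eval (F + G) c = mpoly_eval F c + mpoly_eval G c"
proof -
  let ?M = "Poly_Mapping.keys F \<union> Poly_Mapping.keys G"
  have "Poly_Mapping.keys (F + G) \<subseteq> ?M" by (rule Poly_Mapping.keys_add)
  then show ?thesis
    by (simp add: mpoly_eval_superset[of ?M] lookup_add distrib_right sum.distrib)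
qed

lemma mpoly_eval_0 [simp]: "mpoly_eval 0 c = 0"
  by (simp add: mpoly_eval_def)

lemma mpoly_eval_sum: "mpoly_eval (\<Sum>j\<in>J. F j) c = (\<Sum>j\<in>J. mpoly_eval (F j) c)"
  by (induction J rule: infinite_finite_induct) (auto simp: mpoly_eval_add)

lemma mpoly_eval_single:
  "mpoly_eval (Poly_Mapping.single m a) c = a * (\<Prod>i\<in>UNIV. c i ^ Poly_Mapping.lookup m i)"
  by (subst mpoly_eval_superset[of "{m}"]) auto

lemma poly_mapping_sum_single:
  "(\<Sum>m\<in>Poly_Mapping.keys F. Poly_Mapping.single m (Poly_Mapping.lookup F m)) = F"
  by (rule poly_mapping_eqI)
    (auto simp: lookup_sum lookup_single when_def in_keys_iff sum.delta)

lemma mpoly_eval_mult: "mpoly_eval (F * G) c = mpoly_eval F c * mpoly_eval G c"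
proof -
  let ?s = "\<lambda>F m. Poly_Mapping.single m (Poly_Mapping.lookup F m)"
  have "F * G = (\<Sum>m\<in>Poly_Mapping.keys F. ?s F m) * (\<Sum>m\<in>Poly_Mapping.keys G. ?s G m)"
    by (simp only: poly_mapping_sum_single)
  also have "\<dots> = (\<Sum>m\<in>Poly_Mapping.keys F. \<Sum>m'\<in>Poly_Mapping.keys G.
      Poly_Mapping.single (m + m') (Poly_Mapping.lookup F m * Poly_Mapping.lookup G m'))"
    by (simp add: sum_product mult_single)
  finally show ?thesis
    unfolding mpoly_eval_def[of F] mpoly_eval_def[of G] sum_product
    by (simp add: mpoly_eval_sum mpoly_eval_single lookup_add power_add prod.distrib mult_ac)
qed

lemma mpoly_eval_1: "mpoly_eval 1 c = 1"
  using mpoly_eval_single[of 0 1 c] by (simp flip: single_one)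

lemma mpoly_eval_eq_0_imp:
  fixes H :: "('n::finite, 'k::idom) mpoly"
  assumes "infinite X" "\<And>c. (\<And>i. c i \<in> X) \<Longrightarrow> mpoly_eval H c = 0"
  shows "H = 0"
proof (rule poly_mapping_eqI)
  fix m
  have "Poly_Mapping.lookup H m = 0" if "m \<in> Poly_Mapping.keys H"
    using assms that
    by (intro monomials_independent[of X UNIV "Poly_Mapping.keys H" Poly_Mapping.lookup "Poly_Mapping.lookup H"])
      (auto simp: mpoly_eval_def intro!: poly_mapping_eqI)
  then show "Poly_Mapping.lookup H m = Poly_Mapping.lookup 0 m" by (auto simp: in_keys_iff)
qed

text \<open>The way back from functions to formal polynomials: \<open>relatively_prime\<close>
  speaks of the latter, while factorization is carried out with the former.\<close>

lemma mpoly_eval_inj: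
  fixes F G :: "('n::finite, 'k::idom) mpoly"
  assumes "infinite X" "\<And>c. (\<And>i. c i \<in> X) \<Longrightarrow> mpoly_eval F c = mpoly_eval G c"
  shows "F = G"
proof -
  have "mpoly_eval (F - G) c = mpoly_eval F c - mpoly_eval G c" for c
    using mpoly_eval_add[of "F - G" G c] by simp
  then have "F - G = 0" using assms by (intro mpoly_eval_eq_0_imp[of X]) auto
  then show ?thesis by simp
qed

lemma mpoly_eval_in_poly_funs:
  "(\<lambda>c. mpoly_eval H (\<lambda>i. h (c i))) \<in> poly_funs h UNIV"
  unfolding mpoly_eval_def
  by (intro poly_funs_sum poly_funs.mult poly_funs.const poly_funs_prod poly_funs_power
      poly_funs.var UNIV_I)

lemma poly_funs_mpoly_evalE:
  fixes f :: "('n::finite \<Rightarrow> 'b) \<Rightarrow> 'k::comm_ring_1"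
  assumes "f \<in> poly_funs h UNIV"
  obtains H where "\<And>c. f c = mpoly_eval H (\<lambda>i. h (c i))"
proof -
  have "\<exists>H. \<forall>c. f c = mpoly_eval H (\<lambda>i. h (c i))"
    using assms
  proof (induction rule: poly_funs.induct)
    case (const a)
    show ?case by (intro exI[of _ "Poly_Mapping.single 0 a"]) (simp add: mpoly_eval_single)
  next
    case (var i)
    have "(\<Prod>j\<in>UNIV. h (c j) ^ (Poly_Mapping.lookup (Poly_Mapping.single i 1) j)) = h (c i)" for c
    proof -
      have "(\<Prod>j\<in>UNIV. h (c j) ^ (Poly_Mapping.lookup (Poly_Mapping.single i 1) j)) =
          (\<Prod>j\<in>UNIV. if j = i then h (c j) else 1)"
        by (intro prod.cong) (auto simp: lookup_single when_def)
      then show ?thesis by simp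
    qed
    then show ?case
      by (intro exI[of _ "Poly_Mapping.single (Poly_Mapping.single i 1) 1"]) (simp add: mpoly_eval_single)
  next
    case (add f g)
    then show ?case using mpoly_eval_add by metis
  next
    case (mult f g)
    then show ?case using mpoly_eval_mult by metis
  qed
  then show ?thesis using that by blast
qed

section \<open>Elimination along a direction\<close>

lemma coeff_mult_degree_bounds:
  fixes p q :: "'b::comm_semiring_0 poly"
  assumes "degree p \<le> m" "degree q \<le> n"
  shows "coeff (p * q) (m + n) = coeff p m * coeff q n"
proof -
  have "(\<Sum>i\<le>m + n. coeff p i * coeff q (m + n - i)) =
      (\<Sum>i\<le>m + n. if i = m then coeff p m * coeff q n else 0)"
  proof (rule sum.cong)
    fix i
    consider "i = m" | "m < i" | "n < m + n - i" by linarith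
    then show "coeff p i * coeff q (m + n - i) = (if i = m then coeff p m * coeff q n else 0)"
      by cases (use assms in \<open>auto simp: coeff_eq_0\<close>)
  qed simp
  then show ?thesis by (simp add: coeff_mult)
qed

text \<open>The coefficient is read off at the sum of the exponents, which may exceed the actual
  degree when some \<open>b i\<close> is zero; both sides of the equation are then zero.\<close>

lemma coeff_prod_linear_powers:
  fixes a b :: "'n \<Rightarrow> 'b::comm_semiring_1"
  assumes "finite A"
  shows "degree (\<Prod>i\<in>A. [:a i, b i:] ^ e i) \<le> (\<Sum>i\<in>A. e i) \<and>
    coeff (\<Prod>i\<in>A. [:a i, b i:] ^ e i) (\<Sum>i\<in>A. e i) = (\<Prod>i\<in>A. b i ^ e i)"
  using assms
proof (induction rule: finite_induct)
  case (insert j A)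
  have 1: "degree ([:a j, b j:] ^ k) \<le> k \<and> coeff ([:a j, b j:] ^ k) k = b j ^ k" for k
  proof (induction k)
    case (Suc k)
    have "degree [:a j, b j:] \<le> 1" by simp
    then show ?case
      using Suc coeff_mult_degree_bounds[of "[:a j, b j:]" 1 "[:a j, b j:] ^ k" k]
        degree_mult_le[of "[:a j, b j:]" "[:a j, b j:] ^ k"]
      by auto
  qed simp
  show ?case
    using insert 1[of "e j"]
      coeff_mult_degree_bounds[of "[:a j, b j:] ^ e j" "e j" "\<Prod>i\<in>A. [:a i, b i:] ^ e i" "\<Sum>i\<in>A. e i"]
      degree_mult_le[of "[:a j, b j:] ^ e j" "\<Prod>i\<in>A. [:a i, b i:] ^ e i"]
    by auto
qed simp

text \<open>The direction is chosen outside the zeros of the homogeneous part of top degree.\<close>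

lemma mpoly_direction:
  fixes H :: "('n::finite, 'b::idom) mpoly"
  assumes inf: "infinite (UNIV :: 'b set)" and "H \<noteq> 0"
  obtains d a l where "l i0 = 1" "a \<noteq> 0"
    "\<And>c. \<exists>p. degree p = d \<and> lead_coeff p = a \<and> (\<forall>x. poly p x = mpoly_eval H (\<lambda>i. c i + x * l i))"
proof -
  let ?K = "Poly_Mapping.keys H"
  let ?tot = "\<lambda>m. \<Sum>i\<in>UNIV. Poly_Mapping.lookup m (i :: 'n)"
  define d where "d = Max (?tot ` ?K)"
  define M where "M = {m \<in> ?K. ?tot m = d}"
  have "?K \<noteq> {}" using \<open>H \<noteq> 0\<close> by (metis poly_mapping_sum_single sum.empty)
  then have "d \<in> ?tot ` ?K" unfolding d_def by (intro Max_in) auto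
  then obtain m0 where m0: "m0 \<in> M" unfolding M_def by auto
  have le_d: "?tot m \<le> d" if "m \<in> ?K" for m
    unfolding d_def using that by (intro Max_ge) auto
  \<comment> \<open>Setting coordinate \<open>i0\<close> to 1 merges no monomials: in
    \<open>M\<close> all total degrees equal \<open>d\<close>, so the exponent of \<open>i0\<close>
    is determined by the others.\<close>
  have "\<exists>c. (\<Sum>m\<in>M. Poly_Mapping.lookup H m * (\<Prod>i\<in>UNIV - {i0}. c i ^ Poly_Mapping.lookup m i)) \<noteq> 0"
  proof (rule ccontr)
    assume neg: "\<not> ?thesis"
    have "Poly_Mapping.lookup H m0 = 0"
    proof (rule monomials_independent[where X = UNIV and A = "UNIV - {i0}" and M = M
          and e = Poly_Mapping.lookup])
      fix m m' assume m: "m \<in> M" "m' \<in> M"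
        "\<forall>i\<in>UNIV - {i0}. Poly_Mapping.lookup m i = Poly_Mapping.lookup m' i"
      have tot: "?tot m = Poly_Mapping.lookup m i0 + (\<Sum>i\<in>UNIV - {i0}. Poly_Mapping.lookup m i)" for m
        by (rule sum.remove) auto
      have "(\<Sum>i\<in>UNIV - {i0}. Poly_Mapping.lookup m i) =
          (\<Sum>i\<in>UNIV - {i0}. Poly_Mapping.lookup m' i)"
        using m(3) by (intro sum.cong) auto
      then have "Poly_Mapping.lookup m i0 = Poly_Mapping.lookup m' i0"
        using m(1,2) tot[of m] tot[of m'] unfolding M_def by auto
      then show "m = m'" using m(3) by (intro poly_mapping_eqI) blast
    qed (use inf m0 neg in \<open>auto simp: M_def\<close>)
    then show False using m0 by (auto simp: M_def in_keys_iff)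
  qed
  then obtain c0 where c0:
    "(\<Sum>m\<in>M. Poly_Mapping.lookup H m * (\<Prod>i\<in>UNIV - {i0}. c0 i ^ Poly_Mapping.lookup m i)) \<noteq> 0" ..
  define l where "l = c0(i0 := 1)"
  define a where "a = (\<Sum>m\<in>M. Poly_Mapping.lookup H m * (\<Prod>i\<in>UNIV. l i ^ Poly_Mapping.lookup m i))"
  have "(\<Prod>i\<in>UNIV. l i ^ Poly_Mapping.lookup m i) =
      (\<Prod>i\<in>UNIV - {i0}. c0 i ^ Poly_Mapping.lookup m i)" for m
    by (subst prod.remove[of UNIV i0]) (auto simp: l_def intro!: prod.cong)
  then have "a \<noteq> 0" using c0 by (simp add: a_def)
  moreover have "l i0 = 1" by (simp add: l_def)
  moreover have "\<exists>p. degree p = d \<and> lead_coeff p = a \<and>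
      (\<forall>x. poly p x = mpoly_eval H (\<lambda>i. c i + x * l i))" for c
  proof -
    define P where "P m = (\<Prod>i\<in>UNIV. [:c i, l i:] ^ Poly_Mapping.lookup m i)" for m
    define p where "p = (\<Sum>m\<in>?K. smult (Poly_Mapping.lookup H m) (P m))"
    have P: "degree (P m) \<le> ?tot m" "coeff (P m) (?tot m) = (\<Prod>i\<in>UNIV. l i ^ Poly_Mapping.lookup m i)" for m
      unfolding P_def using coeff_prod_linear_powers[of UNIV c l "Poly_Mapping.lookup m"] by auto
    have "degree (smult (Poly_Mapping.lookup H m) (P m)) \<le> d" if "m \<in> ?K" for m
      using P(1)[of m] le_d[OF that] degree_smult_le[of "Poly_Mapping.lookup H m" "P m"] by linarith
    then have deg: "degree p \<le> d" unfolding p_def by (intro degree_sum_le) auto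
    have "coeff p d = (\<Sum>m\<in>?K. Poly_Mapping.lookup H m * coeff (P m) d)"
      unfolding p_def by (simp add: coeff_sum)
    also have "\<dots> = (\<Sum>m\<in>M. Poly_Mapping.lookup H m * coeff (P m) d)"
    proof (rule sum.mono_neutral_right)
      show "\<forall>m\<in>?K - M. Poly_Mapping.lookup H m * coeff (P m) d = 0"
      proof
        fix m assume "m \<in> ?K - M"
        then have "?tot m < d" using le_d[of m] by (auto simp: M_def)
        then have "coeff (P m) d = 0" using P(1)[of m] by (intro coeff_eq_0) linarith
        then show "Poly_Mapping.lookup H m * coeff (P m) d = 0" by simp
      qed
    qed (auto simp: M_def)
    also have "\<dots> = a" unfolding a_def using P(2) by (intro sum.cong) (auto simp: M_def)
    finally have "coeff p d = a" .
    moreover from this have "degree p = d" using deg \<open>a \<noteq> 0\<close> le_degree[of p d] by simp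
    moreover have "poly p x = mpoly_eval H (\<lambda>i. c i + x * l i)" for x
      unfolding p_def P_def mpoly_eval_def by (simp add: poly_sum poly_prod)
    ultimately show ?thesis by blast
  qed
  ultimately show ?thesis using that by blast
qed

text \<open>A single \<open>D\<close> serves all points, because only the constants in the
  construction of \<open>f\<close> carry denominators.\<close>

lemma poly_funs_clear_denominators:
  fixes f :: "('n \<Rightarrow> 'b::idom) \<Rightarrow> 'b fract"
  assumes "f \<in> poly_funs to_fract S"
  shows "\<exists>D g. D \<noteq> 0 \<and> g \<in> poly_funs id S \<and> (\<forall>c. to_fract (g c) = to_fract D * f c)"
  using assms
proof (induction rule: poly_funs.induct)
  case (const a)
  obtain x y where "a = Fract x y" "y \<noteq> 0" by (cases a)
  then have "to_fract x = to_fract y * a" by (simp add: Fract_conv_to_fract)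
  then show ?case using \<open>y \<noteq> 0\<close> poly_funs.const by (metis (no_types, lifting))
next
  case (var i)
  then have "(\<lambda>c. c i) \<in> poly_funs id S" using poly_funs.var[of i S id] by simp
  moreover have "\<forall>c. to_fract (c i) = to_fract 1 * to_fract (c i)" by simp
  ultimately show ?case using one_neq_zero by blast
next
  case (add f1 f2)
  then obtain D1 g1 D2 g2 where *: "D1 \<noteq> 0" "g1 \<in> poly_funs id S" "\<And>c. to_fract (g1 c) = to_fract D1 * f1 c"
    "D2 \<noteq> 0" "g2 \<in> poly_funs id S" "\<And>c. to_fract (g2 c) = to_fract D2 * f2 c" by metis
  have "(\<lambda>c. D2 * g1 c + D1 * g2 c) \<in> poly_funs id S"
    using * by (intro poly_funs.intros)
  moreover have "\<forall>c. to_fract (D2 * g1 c + D1 * g2 c) = to_fract (D1 * D2) * (f1 c + f2 c)"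
    by (simp add: * algebra_simps)
  moreover have "D1 * D2 \<noteq> 0" using * by simp
  ultimately show ?case by blast
next
  case (mult f1 f2)
  then obtain D1 g1 D2 g2 where *: "D1 \<noteq> 0" "g1 \<in> poly_funs id S" "\<And>c. to_fract (g1 c) = to_fract D1 * f1 c"
    "D2 \<noteq> 0" "g2 \<in> poly_funs id S" "\<And>c. to_fract (g2 c) = to_fract D2 * f2 c" by metis
  have "(\<lambda>c. g1 c * g2 c) \<in> poly_funs id S"
    using * by (intro poly_funs.intros)
  moreover have "\<forall>c. to_fract (g1 c * g2 c) = to_fract (D1 * D2) * (f1 c * f2 c)"
    by (simp add: * algebra_simps)
  moreover have "D1 * D2 \<noteq> 0" using * by simp
  ultimately show ?case by blast
qed

lemma mpoly_eval_to_fract: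
  fixes H :: "('n::finite, 'b::idom) mpoly"
  shows "mpoly_eval (mpoly_to_fract H) (\<lambda>i. to_fract (c i)) = to_fract (mpoly_eval H c)"
proof -
  have l: "Poly_Mapping.lookup (mpoly_to_fract H) m = to_fract (Poly_Mapping.lookup H m)" for m
    by (simp add: mpoly_to_fract_def map.rep_eq when_def)
  then have "Poly_Mapping.keys (mpoly_to_fract H) = Poly_Mapping.keys H"
    by (auto simp: in_keys_iff)
  moreover have p: "to_fract (x ^ n) = to_fract x ^ n" for x :: 'b and n
    by (induction n) auto
  moreover have "to_fract (prod f A) = (\<Prod>i\<in>A. to_fract (f i))" for f :: "'n \<Rightarrow> 'b" and A
    by (induction A rule: infinite_finite_induct) auto
  ultimately show ?thesis by (simp add: mpoly_eval_def l)
qed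

text \<open>The shear \<open>\<sigma>\<close> carries the coordinate direction \<open>i0\<close> to
  \<open>l\<close>. Eliminating variable \<open>i0\<close> from the sheared polynomials and undoing
  the shear by \<open>\<tau>\<close> gives \<open>s (\<tau> c)\<close>, which does not change when a
  multiple of \<open>l\<close> is added to \<open>c\<close>. The elimination takes place over the
  fraction field; clearing denominators brings the identity back to \<open>'b\<close>.\<close>

lemma invariant_eliminant:
  fixes H0 H1 :: "('n::finite, 'b::idom) mpoly"
  assumes inf: "infinite (UNIV :: 'b set)"
    and cop: "relatively_prime (mpoly_to_fract H0) (mpoly_to_fract H1)"
    and "H0 \<noteq> 0" "l i0 = 1"
  obtains R A B :: "('n, 'b) mpoly" where "R \<noteq> 0"
    "\<And>c. mpoly_eval R c = mpoly_eval A c * mpoly_eval H0 c + mpoly_eval B c * mpoly_eval H1 c"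
    "\<And>c x. mpoly_eval R (\<lambda>i. c i + x * l i) = mpoly_eval R c"
proof -
  let ?P = "poly_funs (to_fract :: 'b \<Rightarrow> 'b fract) (UNIV :: 'n set)"
  have infr: "infinite (range (to_fract :: 'b \<Rightarrow> 'b fract))"
    using inf by (simp add: range_inj_infinite inj_on_def finite_image_iff)
  define \<sigma> where "\<sigma> c = (\<lambda>i. c i + (if i = i0 then 0 else l i) * c i0)" for c :: "'n \<Rightarrow> 'b"
  define \<tau> where "\<tau> c = (\<lambda>i. c i - (if i = i0 then 0 else l i) * c i0)" for c :: "'n \<Rightarrow> 'b"
  have \<sigma>\<tau>: "\<sigma> (\<tau> c) = c" and \<tau>\<sigma>: "\<tau> (\<sigma> c) = c" for c by (auto simp: \<sigma>_def \<tau>_def)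
  have P\<sigma>: "(\<lambda>c. f (\<sigma> c)) \<in> ?P" if "f \<in> ?P" for f
    by (rule poly_funs_compose[OF that])
      (auto simp: \<sigma>_def intro!: poly_funs.add poly_funs.mult poly_funs.var poly_funs.const)
  have P\<tau>: "(\<lambda>c. f (\<tau> c)) \<in> ?P" if "f \<in> ?P" for f
    by (rule poly_funs_compose[OF that])
      (auto simp: \<tau>_def intro!: poly_funs_diff poly_funs.mult poly_funs.var poly_funs.const)
  define f where "f = (\<lambda>(H :: ('n, 'b) mpoly) c. to_fract (mpoly_eval H c))"
  have f_eq: "f H = (\<lambda>c. mpoly_eval (mpoly_to_fract H) (\<lambda>i. to_fract (c i)))" for H :: "('n, 'b) mpoly"
    unfolding f_def by (simp add: mpoly_eval_to_fract)
  have fP: "f H \<in> ?P" for H unfolding f_eq by (rule mpoly_eval_in_poly_funs)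
  obtain c0 where "mpoly_eval H0 c0 \<noteq> 0"
    using mpoly_eval_eq_0_imp[OF inf, of H0] \<open>H0 \<noteq> 0\<close> by blast
  then have "f H0 (\<sigma> (\<tau> c0)) \<noteq> 0" by (simp add: f_def \<sigma>\<tau>)
  then have f0: "(\<lambda>c. f H0 (\<sigma> c)) \<noteq> 0" by (metis zero_fun_apply)
  \<comment> \<open>A divisor in sheared coordinates becomes a formal divisor of the original
    polynomial: compose with \<open>\<tau>\<close> and compare values at integral points, which
    suffice because there are infinitely many in each coordinate.\<close>
  have dvd: "\<exists>W. mpoly_to_fract H = D * W"
    if D: "\<And>c. d (\<tau> c) = mpoly_eval D (\<lambda>i. to_fract (c i))" and dv: "dvd_in ?P d (\<lambda>c. f H (\<sigma> c))" for H d D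
  proof -
    obtain w where w: "w \<in> ?P" "(\<lambda>c. f H (\<sigma> c)) = d * w" using dv unfolding dvd_in_def by blast
    obtain W where W: "\<And>c. w (\<tau> c) = mpoly_eval W (\<lambda>i. to_fract (c i))"
      using poly_funs_mpoly_evalE[OF P\<tau>[OF w(1)]] by blast
    have "mpoly_to_fract H = D * W"
    proof (rule mpoly_eval_inj[OF infr])
      fix c' :: "'n \<Rightarrow> 'b fract" assume "\<And>i. c' i \<in> range to_fract"
      then have "\<forall>i. \<exists>x. c' i = to_fract x" by blast
      then obtain c where "\<forall>i. c' i = to_fract (c i)" by (rule choice[THEN exE])
      then have c: "c' = (\<lambda>i. to_fract (c i))" by blast
      have "f H c = f H (\<sigma> (\<tau> c))" by (simp add: \<sigma>\<tau>)
      also have "\<dots> = d (\<tau> c) * w (\<tau> c)" using fun_cong[OF w(2), of "\<tau> c"] by simp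
      finally show "mpoly_eval (mpoly_to_fract H) c' = mpoly_eval (D * W) c'"
        unfolding c mpoly_eval_mult D[symmetric] W[symmetric] by (simp add: f_eq)
    qed
    then show ?thesis by blast
  qed
  have cop': "unit_in ?P d" if d: "d \<in> ?P" "dvd_in ?P d (\<lambda>c. f H0 (\<sigma> c))" "dvd_in ?P d (\<lambda>c. f H1 (\<sigma> c))" for d
  proof -
    obtain D where D: "\<And>c. d (\<tau> c) = mpoly_eval D (\<lambda>i. to_fract (c i))"
      using poly_funs_mpoly_evalE[OF P\<tau>[OF d(1)]] by blast
    have "D dvd mpoly_to_fract H0" "D dvd mpoly_to_fract H1"
      using dvd[OF D d(2)] dvd[OF D d(3)] by (auto simp: dvd_def)
    then have "D dvd 1" using cop unfolding relatively_prime_def by blast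
    then obtain Z where Z: "1 = D * Z" unfolding dvd_def by blast
    define z where "z c = mpoly_eval Z (\<lambda>i. to_fract (\<sigma> c i))" for c
    have "z \<in> ?P" unfolding z_def by (rule P\<sigma>) (rule mpoly_eval_in_poly_funs)
    moreover have "1 = d * z"
    proof
      fix c
      have "d c * z c = d (\<tau> (\<sigma> c)) * z c" by (simp add: \<tau>\<sigma>)
      also have "\<dots> = mpoly_eval (D * Z) (\<lambda>i. to_fract (\<sigma> c i))"
        unfolding D z_def mpoly_eval_mult ..
      finally show "1 c = (d * z) c" by (simp flip: Z add: mpoly_eval_1)
    qed
    ultimately show ?thesis using d unfolding unit_in_def dvd_in_def by blast
  qed
  obtain s A B where s: "s \<in> poly_funs to_fract (UNIV - {i0})" "s \<noteq> 0" "A \<in> ?P" "B \<in> ?P"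
    "s = A * (\<lambda>c. f H0 (\<sigma> c)) + B * (\<lambda>c. f H1 (\<sigma> c))"
    using poly_funs_elimination[where i = i0, OF infr P\<sigma>[OF fP[of H0]] f0 P\<sigma>[OF fP[of H1]] cop'] by blast
  obtain D1 A' where A': "D1 \<noteq> 0" "A' \<in> poly_funs id UNIV" "\<And>c. to_fract (A' c) = to_fract D1 * A (\<tau> c)"
    using poly_funs_clear_denominators[OF P\<tau>[OF s(3)]] by blast
  obtain D2 B' where B': "D2 \<noteq> 0" "B' \<in> poly_funs id UNIV" "\<And>c. to_fract (B' c) = to_fract D2 * B (\<tau> c)"
    using poly_funs_clear_denominators[OF P\<tau>[OF s(4)]] by blast
  \<comment> \<open>Each coefficient is multiplied by the denominator of the other, so that the
    whole combination is scaled by \<open>D1 * D2\<close>.\<close>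
  obtain A'' where A'': "\<And>c. D2 * A' c = mpoly_eval A'' c"
    using poly_funs_mpoly_evalE[OF poly_funs.mult[OF poly_funs.const[of D2] A'(2)]] by auto
  obtain B'' where B'': "\<And>c. D1 * B' c = mpoly_eval B'' c"
    using poly_funs_mpoly_evalE[OF poly_funs.mult[OF poly_funs.const[of D1] B'(2)]] by auto
  define R where "R = A'' * H0 + B'' * H1"
  have R: "mpoly_eval R c = mpoly_eval A'' c * mpoly_eval H0 c + mpoly_eval B'' c * mpoly_eval H1 c" for c
    by (simp add: R_def mpoly_eval_add mpoly_eval_mult)
  have Rs: "to_fract (mpoly_eval R c) = to_fract (D1 * D2) * s (\<tau> c)" for c
    unfolding s(5) R A''[symmetric] B''[symmetric]
    by (simp add: A' B' \<sigma>\<tau> f_def algebra_simps)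
  show ?thesis
  proof
    obtain c where "s c \<noteq> 0" using s(2) by (metis ext zero_fun_apply)
    then have "s (\<tau> (\<sigma> c)) \<noteq> 0" by (simp add: \<tau>\<sigma>)
    then have "to_fract (mpoly_eval R (\<sigma> c)) \<noteq> 0" unfolding Rs using A' B' by simp
    then show "R \<noteq> 0" by auto
    show "mpoly_eval R c = mpoly_eval A'' c * mpoly_eval H0 c + mpoly_eval B'' c * mpoly_eval H1 c" for c
      by (rule R)
    fix c x
    have "s (\<tau> (\<lambda>i. c i + x * l i)) = s (\<tau> c)"
      using \<open>l i0 = 1\<close> by (intro poly_funs_cong[OF s(1)]) (auto simp: \<tau>_def algebra_simps)
    then have "to_fract (mpoly_eval R (\<lambda>i. c i + x * l i)) = to_fract (mpoly_eval R c)"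
      unfolding Rs by simp
    then show "mpoly_eval R (\<lambda>i. c i + x * l i) = mpoly_eval R c" by simp
  qed
qed

section \<open>Roots modulo square-free polynomials\<close>

text \<open>Bounding coefficients instead of the degree includes 0 for every \<open>k\<close>, so
  the set has exactly \<open>q ^ k\<close> elements and shrinks to 0 alone at
  \<open>k = 0\<close>.\<close>

definition polys_below :: "nat \<Rightarrow> 'a::zero poly set"
  where "polys_below k = {x. \<forall>i\<ge>k. coeff x i = 0}"

lemma polys_below_altdef: "x \<in> polys_below k \<longleftrightarrow> x = 0 \<or> degree x < k"
proof
  assume x: "x \<in> polys_below k"
  show "x = 0 \<or> degree x < k"
  proof (rule ccontr)
    assume "\<not> ?thesis"
    then have "x \<noteq> 0" "k \<le> degree x" by auto
    then have "lead_coeff x = 0" using x by (simp only: polys_below_def mem_Collect_eq)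
    then show False using \<open>x \<noteq> 0\<close> by simp
  qed
qed (auto simp: polys_below_def intro: coeff_eq_0)

lemma polys_below_add: "x \<in> polys_below k \<Longrightarrow> y \<in> polys_below k \<Longrightarrow> x + y \<in> polys_below k"
  by (simp add: polys_below_def)

lemma polys_below_diff:
  fixes x y :: "'a::ab_group_add poly"
  shows "x \<in> polys_below k \<Longrightarrow> y \<in> polys_below k \<Longrightarrow> x - y \<in> polys_below k"
  by (simp add: polys_below_def)

lemma zero_in_polys_below [simp]: "0 \<in> polys_below k"
  by (simp add: polys_below_def)

lemma finite_card_polys_below:
  "finite (polys_below k :: 'a::{zero,finite} poly set) \<and>
    card (polys_below k :: 'a poly set) = CARD('a) ^ k"
proof (induction k)
  case 0
  have "polys_below 0 = {0 :: 'a poly}" by (auto simp: polys_below_def poly_eq_iff)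
  then show ?case by simp
next
  case (Suc k)
  have "(polys_below (Suc k) :: 'a poly set) = (\<lambda>(a, x). pCons a x) ` (UNIV \<times> polys_below k)"
  proof (intro subset_antisym subsetI)
    fix x :: "'a poly" assume x: "x \<in> polys_below (Suc k)"
    obtain a y where y: "x = pCons a y" by (cases x) auto
    have "coeff y i = 0" if "k \<le> i" for i
    proof -
      have "coeff x (Suc i) = 0" using x that by (simp add: polys_below_def)
      then show ?thesis by (simp add: y)
    qed
    then have "y \<in> polys_below k" by (simp add: polys_below_def)
    then show "x \<in> (\<lambda>(a, x). pCons a x) ` (UNIV \<times> polys_below k)" using y by force
  qed (auto simp: polys_below_def coeff_pCons split: nat.splits)
  moreover have "inj_on (\<lambda>(a, x). pCons a x) (UNIV \<times> (polys_below k :: 'a poly set))"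
    by (auto simp: inj_on_def)
  ultimately show ?case using Suc by (simp add: card_image card_cartesian_product)
qed

lemmas finite_polys_below = finite_card_polys_below[THEN conjunct1]
lemmas card_polys_below = finite_card_polys_below[THEN conjunct2]

lemma infinite_UNIV_poly: "infinite (UNIV :: 'a::zero_neq_one poly set)"
proof -
  have "inj (\<lambda>n. monom (1 :: 'a) n)" by (rule injI) (metis degree_monom_eq zero_neq_one)
  then show ?thesis using finite_subset[OF subset_UNIV] range_inj_infinite by blast
qed

lemma dvd_poly_diff: "x - y dvd poly f x - poly f y"
  for f :: "'b::comm_ring_1 poly"
proof (induction f)
  case (pCons a f)
  have "poly (pCons a f) x - poly (pCons a f) y = (x - y) * poly f x + y * (poly f x - poly f y)"
    by (simp add: algebra_simps)
  then show ?case using pCons by (metis dvd_add dvd_mult dvd_triv_left)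
qed simp

text \<open>Lagrange's bound modulo a prime: splitting off one root preserves the leading
  coefficient, and any other root is a root of the quotient, because \<open>p\<close> does not
  divide the difference of the two roots.\<close>

lemma card_incongruent_roots_prime:
  fixes f :: "'b::idom poly"
  assumes "prime_elem p" "\<not> p dvd lead_coeff f" "finite A"
    "\<And>x. x \<in> A \<Longrightarrow> p dvd poly f x"
    "\<And>x y. x \<in> A \<Longrightarrow> y \<in> A \<Longrightarrow> p dvd x - y \<Longrightarrow> x = y"
  shows "card A \<le> degree f"
  using assms(2-)
proof (induction "degree f" arbitrary: f A)
  case 0
  then obtain a where a: "f = [:a:]" by (metis degree_eq_zeroE)
  then have "A = {}" using 0 by force
  then show ?case by simp
next
  case (Suc n)
  show ?case
  proof (cases "A = {}")
    case False
    then obtain \<alpha> where \<alpha>: "\<alpha> \<in> A" by blast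
    define g where "g = synthetic_div f \<alpha>"
    have f: "f = [:- \<alpha>, 1:] * g + [:poly f \<alpha>:]"
      unfolding g_def by (rule synthetic_div_correct'[symmetric])
    have deg: "degree g = n" using Suc(2) by (simp add: g_def degree_synthetic_div)
    have "coeff f (Suc n) = coeff g n"
      by (subst f) (simp add: coeff_eq_0 deg)
    then have lead: "\<not> p dvd lead_coeff g" using Suc deg by simp
    have "card (A - {\<alpha>}) \<le> degree g"
    proof (rule Suc.hyps(1))
      fix \<beta> assume \<beta>: "\<beta> \<in> A - {\<alpha>}"
      have "poly f \<beta> = (\<beta> - \<alpha>) * poly g \<beta> + poly f \<alpha>"
        by (subst f) (simp add: algebra_simps)
      moreover have "p dvd poly f \<beta> - poly f \<alpha>" using Suc.prems \<alpha> \<beta> by (intro dvd_diff) auto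
      ultimately have "p dvd (\<beta> - \<alpha>) * poly g \<beta>" by simp
      moreover have "\<not> p dvd \<beta> - \<alpha>" using Suc.prems(4)[of \<beta> \<alpha>] \<alpha> \<beta> by auto
      ultimately show "p dvd poly g \<beta>" using assms(1) by (simp add: prime_elem_dvd_mult_iff)
    qed (use deg lead Suc.prems in auto)
    then show ?thesis using \<alpha> Suc deg by (simp add: card_Diff_singleton)
  qed simp
qed

lemma dvd_poly_mod_iff:
  fixes p :: "'a::field_gcd poly"
  shows "p dvd poly f (x mod p) \<longleftrightarrow> p dvd poly f x"
proof -
  have "p dvd x mod p - x" by (simp flip: mod_eq_dvd_iff)
  then have "p dvd poly f (x mod p) - poly f x" using dvd_poly_diff dvd_trans by blast
  then show ?thesis by (metis diff_add_cancel dvd_add_right_iff)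
qed

text \<open>Induct on the number of primes. For \<open>r = p * s\<close>, square-freeness makes
  \<open>p\<close> and \<open>s\<close> coprime, so an element of \<open>A\<close> is determined by
  its residues modulo \<open>p\<close> and modulo \<open>s\<close>.\<close>

lemma card_incongruent_roots_squarefree:
  fixes f :: "'a::field_gcd poly poly"
  assumes "squarefree r" "coprime r (lead_coeff f)" "finite A"
    "\<And>x. x \<in> A \<Longrightarrow> r dvd poly f x"
    "\<And>x y. x \<in> A \<Longrightarrow> y \<in> A \<Longrightarrow> r dvd x - y \<Longrightarrow> x = y"
  shows "card A \<le> degree f ^ card (prime_factors r)"
  using assms
proof (induction "card (prime_factors r)" arbitrary: r A)
  case 0
  have "r \<noteq> 0" using 0 by auto
  moreover have "prime_factors r = {}" using 0 by simp
  ultimately have "is_unit r" by (simp add: prime_factorization_empty_iff)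
  then have "x = y" if "x \<in> A" "y \<in> A" for x y
    using 0(6)[OF that] by (simp add: unit_imp_dvd)
  then have "card A \<le> Suc 0" using 0 by (subst card_le_Suc0_iff_eq) auto
  then show ?case using 0 by simp
next
  case (Suc n)
  then have "prime_factors r \<noteq> {}" by auto
  then obtain p where p: "p \<in> prime_factors r" by blast
  then have pp: "prime p" "p dvd r" by auto
  then obtain s where s: "r = p * s" unfolding dvd_def by blast
  have nz: "p \<noteq> 0" "s \<noteq> 0" using Suc s by auto
  have "\<not> p dvd s"
  proof
    assume "p dvd s"
    then have "p ^ 2 dvd r" by (simp add: s power2_eq_square)
    then show False using Suc.prems(1) pp by (meson not_prime_unit squarefreeD)
  qed
  then have cop: "coprime p s" using pp by (simp add: prime_imp_coprime)
  have pf: "prime_factors r = insert p (prime_factors s)"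
    using nz pp by (simp add: s prime_factors_product prime_factorization_prime)
  moreover have "p \<notin> prime_factors s" using \<open>\<not> p dvd s\<close> by auto
  ultimately have n: "n = card (prime_factors s)" using Suc(2) by simp
  have mod_eq: "x mod p = y mod p" if "p dvd x mod p - y mod p" for x y p :: "'a poly"
    using that by (metis mod_eq_dvd_iff mod_mod_trivial)
  have 1: "card ((\<lambda>x. x mod p) ` A) \<le> degree f"
  proof (rule card_incongruent_roots_prime)
    show "\<not> p dvd lead_coeff f"
      using Suc.prems(2) pp s by (metis coprime_common_divisor not_prime_unit)
    show "p dvd poly f x" if "x \<in> (\<lambda>x. x mod p) ` A" for x
      using that Suc.prems(4) dvd_poly_mod_iff[of p] pp dvd_trans by blast
    show "x = y" if "x \<in> (\<lambda>x. x mod p) ` A" "y \<in> (\<lambda>x. x mod p) ` A" "p dvd x - y" for x y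
      using that mod_eq by blast
  qed (use pp Suc in auto)
  have 2: "card ((\<lambda>x. x mod s) ` A) \<le> degree f ^ card (prime_factors s)"
  proof (rule Suc.hyps(1)[OF n])
    show "squarefree s" using Suc.prems(1) s squarefree_multD by blast
    show "coprime s (lead_coeff f)" using Suc.prems(2) s by simp
    show "s dvd poly f x" if "x \<in> (\<lambda>x. x mod s) ` A" for x
      using that Suc.prems(4) dvd_poly_mod_iff[of s] s dvd_mult_right by blast
    show "x = y" if "x \<in> (\<lambda>x. x mod s) ` A" "y \<in> (\<lambda>x. x mod s) ` A" "s dvd x - y" for x y
      using that mod_eq by blast
  qed (use Suc in auto)
  have "card A \<le> card (((\<lambda>x. x mod p) ` A) \<times> ((\<lambda>x. x mod s) ` A))"
  proof (rule card_inj_on_le[of "\<lambda>x. (x mod p, x mod s)"])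
    show "inj_on (\<lambda>x. (x mod p, x mod s)) A"
    proof (rule inj_onI)
      fix x y assume xy: "x \<in> A" "y \<in> A" "(x mod p, x mod s) = (y mod p, y mod s)"
      then have "p dvd x - y" "s dvd x - y" by (auto simp: mod_eq_dvd_iff)
      then have "r dvd x - y" using cop unfolding s by (simp add: divides_mult)
      then show "x = y" using Suc.prems(5) xy by blast
    qed
  qed (use Suc in auto)
  also have "\<dots> \<le> degree f * degree f ^ card (prime_factors s)"
    using mult_le_mono[OF 1 2] by (simp only: card_cartesian_product)
  also have "\<dots> = degree f ^ card (prime_factors r)"
    using Suc(2) n by (metis power_Suc)
  finally show ?case .
qed

text \<open>Truncated subtraction is intended: for \<open>degree r\<close> at least \<open>k\<close>
  the quotient is 0, the only element of \<open>polys_below 0\<close>.\<close>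

lemma div_in_polys_below:
  fixes x r :: "'a::field poly"
  assumes "x \<in> polys_below k"
  shows "x div r \<in> polys_below (k - degree r)"
proof (cases "x div r = 0")
  case False
  then have r: "r \<noteq> 0" "x \<noteq> 0" by auto
  have eq: "x div r * r = x - x mod r" by (simp add: minus_mod_eq_div_mult)
  have deg: "degree (x div r * r) = degree (x div r) + degree r"
    using False r by (intro degree_mult_eq)
  have "degree (x div r * r) \<le> degree x"
  proof (rule ccontr)
    assume "\<not> ?thesis"
    moreover have "degree (x div r * r) \<le> max (degree x) (degree (x mod r))"
      unfolding eq by (rule degree_diff_le_max)
    ultimately have "degree (x div r) + degree r \<le> degree (x mod r)" "degree (x mod r) \<noteq> 0"
      using deg by auto
    then show False using degree_mod_less[OF r(1), of x] by auto
  qed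
  then show ?thesis using assms r deg by (auto simp: polys_below_altdef)
qed simp

lemma card_ge_2_field: "CARD('a::{field_gcd,finite}) \<ge> 2"
  using card_mono[of "UNIV :: 'a set" "{0, 1}"] by simp

lemma prime_factors_mono_card:
  "s dvd r \<Longrightarrow> r \<noteq> 0 \<Longrightarrow> card (prime_factors s) \<le> card (prime_factors r)"
  by (intro card_mono dvd_prime_factors) auto

text \<open>The part \<open>g\<close> that \<open>r\<close> shares with the leading coefficient is
  given up, and the roots modulo the cofactor \<open>s\<close> are counted. Since \<open>g\<close>
  divides the leading coefficient, this loses at most the factor
  \<open>q ^ degree (lead_coeff f)\<close>, uniformly in \<open>r\<close>.\<close>

lemma card_roots_below:
  fixes f :: "'a::{field_gcd,finite} poly poly"
  assumes "squarefree r" "f \<noteq> 0"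
  shows "real (card {x \<in> polys_below k. r dvd poly f x}) \<le>
    real (Suc (degree f)) ^ card (prime_factors r) *
      (real CARD('a) ^ degree (lead_coeff f) * (real CARD('a) ^ k / real CARD('a) ^ degree r) + 1)"
proof -
  let ?q = "real CARD('a)"
  have q: "?q \<ge> 1" using card_ge_2_field[where 'a='a] by simp
  have r0: "r \<noteq> 0" using assms by auto
  define a where "a = lead_coeff f"
  define g where "g = gcd r a"
  have a0: "a \<noteq> 0" using assms by (simp add: a_def)
  obtain s where s: "r = g * s" unfolding g_def using gcd_dvd1 by (metis dvd_def)
  have nz: "g \<noteq> 0" "s \<noteq> 0" using s r0 by auto
  \<comment> \<open>A common divisor of \<open>s\<close> and \<open>a\<close> also divides
    \<open>g\<close>, so its square divides the square-free \<open>r\<close>.\<close>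
  have "coprime s a"
  proof -
    let ?e = "gcd s a"
    have "?e dvd g" unfolding g_def by (intro gcd_greatest) (auto simp: s)
    then have "?e ^ 2 dvd r" unfolding s power2_eq_square by (intro mult_dvd_mono) auto
    then have "is_unit ?e" using squarefreeD assms(1) by blast
    then show ?thesis by (simp add: coprime_iff_gcd_eq_1)
  qed
  moreover have "squarefree s" using assms(1) s squarefree_multD by blast
  moreover define Z where "Z = {x \<in> polys_below k. s dvd poly f x}"
  moreover have "finite Z" unfolding Z_def by (rule finite_subset[OF _ finite_polys_below]) auto
  ultimately have "card ((\<lambda>x. x mod s) ` Z) \<le> degree f ^ card (prime_factors s)"
    unfolding a_def by (intro card_incongruent_roots_squarefree)
      (auto simp: mod_eq_dvd_iff[symmetric] dvd_poly_mod_iff)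
  \<comment> \<open>The successor keeps the base at least 1, as needed to pass from the primes of
    \<open>s\<close> to those of \<open>r\<close>.\<close>
  also have "\<dots> \<le> Suc (degree f) ^ card (prime_factors s)" by (intro power_mono) auto
  also have "\<dots> \<le> Suc (degree f) ^ card (prime_factors r)"
    using r0 s by (intro power_increasing prime_factors_mono_card) auto
  finally have res: "card ((\<lambda>x. x mod s) ` Z) \<le> Suc (degree f) ^ card (prime_factors r)" .
  have "card Z \<le> card (((\<lambda>x. x mod s) ` Z) \<times> (polys_below (k - degree s) :: 'a poly set))"
  proof (rule card_inj_on_le[of "\<lambda>x. (x mod s, x div s)"])
    show "inj_on (\<lambda>x. (x mod s, x div s)) Z"
      by (rule inj_onI) (metis div_mult_mod_eq prod.inject)
    show "(\<lambda>x. (x mod s, x div s)) ` Z \<subseteq> (\<lambda>x. x mod s) ` Z \<times> polys_below (k - degree s)"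
      using div_in_polys_below by (auto simp: Z_def)
  qed (use \<open>finite Z\<close> finite_polys_below in auto)
  also have "\<dots> \<le> Suc (degree f) ^ card (prime_factors r) * CARD('a) ^ (k - degree s)"
    using res by (simp add: card_cartesian_product card_polys_below)
  finally have "real (card Z) \<le> real (Suc (degree f) ^ card (prime_factors r) * CARD('a) ^ (k - degree s))"
    by (rule of_nat_mono)
  also have "\<dots> = real (Suc (degree f)) ^ card (prime_factors r) * ?q ^ (k - degree s)" by simp
  finally have Z_le: "real (card Z) \<le> real (Suc (degree f)) ^ card (prime_factors r) * ?q ^ (k - degree s)" .
  \<comment> \<open>The summand 1 covers \<open>s\<close> of degree above \<open>k\<close>, where
    the truncated exponent is 0 and each residue class contributes at most one point.\<close>
  have "?q ^ (k - degree s) \<le> ?q ^ degree a * (?q ^ k / ?q ^ degree r) + 1"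
  proof (cases "degree s \<le> k")
    case True
    have "degree g \<le> degree a" unfolding g_def using a0 by (intro dvd_imp_degree_le) auto
    then have "degree r \<le> degree a + degree s" using nz by (simp add: s degree_mult_eq)
    then have "?q ^ (k - degree s) * ?q ^ degree r \<le> ?q ^ (k - degree s) * ?q ^ (degree a + degree s)"
      using q by (intro mult_left_mono power_increasing) auto
    also have "\<dots> = ?q ^ degree a * ?q ^ k"
      using True by (simp add: add.commute flip: power_add)
    finally have "?q ^ (k - degree s) \<le> ?q ^ degree a * (?q ^ k / ?q ^ degree r)"
      using q by (simp add: field_simps)
    then show ?thesis by simp
  qed simp
  then have "real (Suc (degree f)) ^ card (prime_factors r) * ?q ^ (k - degree s) \<le>
      real (Suc (degree f)) ^ card (prime_factors r) * (?q ^ degree a * (?q ^ k / ?q ^ degree r) + 1)"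
    by (intro mult_left_mono) auto
  moreover have "card {x \<in> polys_below k. r dvd poly f x} \<le> card Z"
    using \<open>finite Z\<close> unfolding Z_def s by (intro card_mono) (auto dest: dvd_mult_right)
  ultimately show ?thesis using Z_le unfolding a_def by linarith
qed

text \<open>The classical divisor bound. A prime of degree at least \<open>k\<close> pays for its
  own factor \<open>A\<close> by \<open>q powr (\<epsilon> * degree p)\<close>, and these payments
  multiply to at most \<open>q powr (\<epsilon> * degree r)\<close>. The primes of smaller degree
  are bounded in number independently of \<open>r\<close> and go into \<open>C\<close>.\<close>

lemma power_card_prime_factors_bound:
  fixes A \<epsilon> :: real
  assumes "A \<ge> 1" "\<epsilon> > 0"
  shows "\<exists>C\<ge>1. \<forall>r::'a::{field_gcd,finite} poly. r \<noteq> 0 \<longrightarrow>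
    A ^ card (prime_factors r) \<le> C * real CARD('a) powr (\<epsilon> * degree r)"
proof -
  let ?q = "real CARD('a)"
  have q: "?q > 1" using card_ge_2_field[where 'a='a] by simp
  obtain k :: nat where k: "A \<le> ?q powr (\<epsilon> * k)"
  proof -
    obtain k :: nat where "log ?q A / \<epsilon> \<le> k" using real_arch_simple by blast
    then have "log ?q A \<le> \<epsilon> * k" using assms by (simp add: field_simps)
    then have "A \<le> ?q powr (\<epsilon> * k)" using assms q by (simp add: log_le_iff)
    then show ?thesis using that by blast
  qed
  let ?B = "card (polys_below k :: 'a poly set)"
  have "A ^ card (prime_factors r) \<le> A ^ ?B * ?q powr (\<epsilon> * degree r)" if r: "r \<noteq> 0" for r :: "'a poly"
  proof -
    let ?S = "prime_factors r \<inter> polys_below k" and ?L = "prime_factors r - polys_below k"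
    have "card ?S \<le> ?B" using finite_polys_below by (intro card_mono) auto
    then have "A ^ card ?S \<le> A ^ ?B" using assms by (intro power_increasing) auto
    moreover have "A ^ card ?L \<le> ?q powr (\<epsilon> * degree r)"
    proof -
      have "A ^ card ?L = (\<Prod>p\<in>?L. A)" by simp
      also have "\<dots> \<le> (\<Prod>p\<in>?L. ?q powr (\<epsilon> * degree p))"
      proof (rule prod_mono)
        fix p assume "p \<in> ?L"
        then have "\<epsilon> * real k \<le> \<epsilon> * real (degree p)"
          using assms by (auto simp: polys_below_altdef)
        then show "0 \<le> A \<and> A \<le> ?q powr (\<epsilon> * degree p)"
          using assms k q powr_mono[of "\<epsilon> * k" "\<epsilon> * degree p" ?q] by linarith
      qed
      also have "\<dots> = ?q powr (\<Sum>p\<in>?L. \<epsilon> * degree p)"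
        using q by (simp add: powr_sum)
      also have "(\<Sum>p\<in>?L. \<epsilon> * degree p) = \<epsilon> * degree (\<Prod>p\<in>?L. p)"
        by (subst degree_prod_eq_sum_degree) (auto simp: sum_distrib_left)
      also have "degree (\<Prod>p\<in>?L. p) \<le> degree r"
      proof (intro dvd_imp_degree_le r)
        have "(\<Prod>p\<in>?L. p) dvd (\<Prod>p\<in>prime_factors r. p)"
          by (intro prod_dvd_prod_subset) auto
        also have "\<dots> dvd (\<Prod>p\<in>prime_factors r. p ^ multiplicity p r)"
          by (intro prod_dvd_prod dvd_power) (auto simp: prime_factors_multiplicity)
        also have "\<dots> dvd r" using r by (simp add: prod_prime_factors)
        finally show "(\<Prod>p\<in>?L. p) dvd r" .
      qed
      finally show ?thesis using assms q by simp
    qed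
    moreover have "card (prime_factors r) = card ?S + card ?L"
      by (subst card_Un_disjoint[symmetric]) (auto intro: arg_cong[where f = card])
    ultimately show ?thesis using assms by (simp add: power_add mult_mono)
  qed
  moreover have "A ^ ?B \<ge> 1" using assms by simp
  ultimately show ?thesis by blast
qed

definition squarefree_monics :: "nat \<Rightarrow> 'a::field_gcd poly set"
  where "squarefree_monics y = {r. lead_coeff r = 1 \<and> squarefree r \<and> degree r = y}"

lemma squarefree_monics_subset: "squarefree_monics y \<subseteq> polys_below (Suc y)"
  by (auto simp: squarefree_monics_def polys_below_altdef)

lemma finite_squarefree_monics: "finite (squarefree_monics y :: 'a::{field_gcd,finite} poly set)"
  using finite_subset[OF squarefree_monics_subset finite_polys_below] .

lemma card_squarefree_monics:
  "card (squarefree_monics y :: 'a::{field_gcd,finite} poly set) \<le> CARD('a) ^ Suc y"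
  using card_mono[OF finite_polys_below squarefree_monics_subset] card_polys_below by metis

text \<open>A square-free monic polynomial is the product of its prime factors, hence determined by
  a subset of the primes of \<open>N\<close>.\<close>

lemma card_squarefree_monic_divisors:
  fixes N :: "'a::{field_gcd,finite} poly"
  assumes "N \<noteq> 0"
  shows "card {r \<in> squarefree_monics y. r dvd N} \<le> 2 ^ card (prime_factors N)"
proof -
  have "card {r \<in> squarefree_monics y. r dvd N} \<le> card (Pow (prime_factors N))"
  proof (rule card_inj_on_le[of prime_factors])
    show "inj_on prime_factors {r \<in> squarefree_monics y. r dvd N}"
    proof (rule inj_on_inverseI[of _ "prod (\<lambda>p. p)"])
      fix r assume "r \<in> {r \<in> squarefree_monics y. r dvd N}"
      then have r: "lead_coeff r = 1" "squarefree r" "r \<noteq> 0" by (auto simp: squarefree_monics_def)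
      have "normalize r = (\<Prod>p\<in>prime_factors r. p ^ multiplicity p r)"
        using r by (simp add: prod_prime_factors)
      also have "\<dots> = \<Prod> (prime_factors r)"
        using r squarefree_factorial_semiring'[of r] by (intro prod.cong) auto
      finally show "\<Prod> (prime_factors r) = r"
        using r by (simp add: normalize_poly_def flip: one_pCons)
    qed
    show "prime_factors ` {r \<in> squarefree_monics y. r dvd N} \<subseteq> Pow (prime_factors N)"
      using dvd_prime_factors[OF assms] by blast
  qed auto
  then show ?thesis by (simp add: card_Pow)
qed

section \<open>Counting in boxes\<close>

definition poly_box :: "nat \<Rightarrow> ('n \<Rightarrow> 'a::zero poly) set"
  where "poly_box M = {c. \<forall>i. c i \<in> polys_below M}"

lemma finite_card_poly_box:
  "finite (poly_box M :: ('n::finite \<Rightarrow> 'a::{zero,finite} poly) set) \<and>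
    card (poly_box M :: ('n \<Rightarrow> 'a poly) set) = CARD('a) ^ (M * CARD('n))"
proof -
  have "(poly_box M :: ('n \<Rightarrow> 'a poly) set) = (UNIV \<rightarrow>\<^sub>E polys_below M)"
    by (auto simp: poly_box_def PiE_def)
  then show ?thesis
    by (simp add: card_PiE card_polys_below finite_PiE finite_polys_below power_mult)
qed

lemmas finite_poly_box = finite_card_poly_box[THEN conjunct1]
lemmas card_poly_box = finite_card_poly_box[THEN conjunct2]

lemma poly_box_shift:
  fixes c l :: "'n \<Rightarrow> 'a::idom poly"
  assumes "c \<in> poly_box M" "x \<in> polys_below (M - L)" "\<And>i. degree (l i) \<le> L"
  shows "(\<lambda>i. c i + x * l i) \<in> poly_box M" "(\<lambda>i. c i - x * l i) \<in> poly_box M"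
proof -
  have "x * l i \<in> polys_below M" for i
    using assms(2) assms(3)[of i] degree_mult_le[of x "l i"] by (auto simp: polys_below_altdef)
  then show "(\<lambda>i. c i + x * l i) \<in> poly_box M" "(\<lambda>i. c i - x * l i) \<in> poly_box M"
    using assms(1) by (auto simp: poly_box_def intro: polys_below_add polys_below_diff)
qed

text \<open>Average over the translates by multiples of the direction, which preserve the box.\<close>

lemma card_poly_box_le_average:
  fixes l :: "'n::finite \<Rightarrow> 'a::{field_gcd,finite} poly"
  assumes l: "\<And>i. degree (l i) \<le> L"
    and B: "\<And>c. c \<in> poly_box M \<Longrightarrow>
      real (card {x \<in> polys_below (M - L). P (\<lambda>i. c i + x * l i)}) \<le> B c"
  shows "real (card {c \<in> poly_box M. P c}) \<le> real CARD('a) ^ L / real CARD('a) ^ M * (\<Sum>c\<in>poly_box M. B c)"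
proof -
  let ?q = "real CARD('a)" and ?X = "polys_below (M - L) :: 'a poly set"
  let ?Box = "poly_box M :: ('n \<Rightarrow> 'a poly) set"
  have q: "?q \<ge> 1" using card_ge_2_field[where 'a='a] by simp
  have shift: "card {c \<in> ?Box. P (\<lambda>i. c i + x * l i)} = card {c \<in> ?Box. P c}" if x: "x \<in> ?X" for x
  proof (rule bij_betw_same_card[of "\<lambda>c i. c i + x * l i"], rule bij_betw_byWitness[of _ "\<lambda>c i. c i - x * l i"])
    show "(\<lambda>c i. c i + x * l i) ` {c \<in> ?Box. P (\<lambda>i. c i + x * l i)} \<subseteq> {c \<in> ?Box. P c}"
      using poly_box_shift(1)[OF _ x l] by auto
    show "(\<lambda>c i. c i - x * l i) ` {c \<in> ?Box. P c} \<subseteq> {c \<in> ?Box. P (\<lambda>i. c i + x * l i)}"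
      using poly_box_shift(2)[OF _ x l] by auto
  qed auto
  have "card ?X * card {c \<in> ?Box. P c} = (\<Sum>x\<in>?X. card {c \<in> ?Box. P (\<lambda>i. c i + x * l i)})"
    using shift by simp
  also have "\<dots> = (\<Sum>x\<in>?X. \<Sum>c\<in>?Box. if P (\<lambda>i. c i + x * l i) then 1 else 0)"
    by (intro sum.cong) (auto simp: sum.If_cases finite_poly_box Int_def)
  also have "\<dots> = (\<Sum>c\<in>?Box. \<Sum>x\<in>?X. if P (\<lambda>i. c i + x * l i) then 1 else 0)"
    by (rule sum.swap)
  also have "\<dots> = (\<Sum>c\<in>?Box. card {x \<in> ?X. P (\<lambda>i. c i + x * l i)})"
    by (intro sum.cong) (auto simp: sum.If_cases finite_polys_below Int_def)
  finally have "real (card ?X * card {c \<in> ?Box. P c}) =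
      (\<Sum>c\<in>?Box. real (card {x \<in> ?X. P (\<lambda>i. c i + x * l i)}))"
    by simp
  also have "\<dots> \<le> (\<Sum>c\<in>?Box. B c)" using B by (intro sum_mono) auto
  finally have *: "?q ^ (M - L) * real (card {c \<in> ?Box. P c}) \<le> (\<Sum>c\<in>?Box. B c)"
    by (simp add: card_polys_below)
  \<comment> \<open>The factor \<open>q ^ L\<close> pays for allowing only multiples below
    \<open>M - L\<close>. It also covers \<open>M < L\<close>, where 0 is the only multiple.\<close>
  have "?q ^ M \<le> ?q ^ L * ?q ^ (M - L)"
    using q by (simp flip: power_add add: power_increasing)
  then have "?q ^ M * real (card {c \<in> ?Box. P c}) \<le> ?q ^ L * ?q ^ (M - L) * real (card {c \<in> ?Box. P c})"
    by (intro mult_right_mono) auto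
  also have "\<dots> \<le> ?q ^ L * (\<Sum>c\<in>?Box. B c)"
    using * q by (simp add: mult.assoc mult_left_mono)
  finally show ?thesis using q by (simp add: field_simps)
qed

lemma direction_degree_bound: "\<exists>L. \<forall>i::'n::finite. degree (l i) \<le> L"
  by (rule exI[of _ "Max (range (\<lambda>i. degree (l i)))"]) auto

text \<open>On each line in a direction chosen for \<open>R\<close> itself there are at most
  \<open>d\<close> zeros. The direction of \<open>H0\<close> would not do: the eliminant to which
  this is applied is constant along it.\<close>

lemma card_zeros_poly_box:
  fixes R :: "('n::finite, 'a::{field_gcd,finite} poly) mpoly"
  assumes "R \<noteq> 0"
  shows "\<exists>C\<ge>0. \<forall>M. real (card {c \<in> poly_box M. mpoly_eval R c = 0}) \<le>
    C * (real CARD('a) ^ (M * CARD('n)) / real CARD('a) ^ M)"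
proof -
  let ?q = "real CARD('a)"
  obtain i0 :: 'n where True by blast
  obtain d a l where l0: "l i0 = 1" and l: "a \<noteq> 0" "\<And>c. \<exists>p. degree p = d \<and> lead_coeff p = a \<and>
      (\<forall>x. poly p x = mpoly_eval R (\<lambda>i. c i + x * l i))"
    by (rule mpoly_direction[where ?i0.0 = i0, OF infinite_UNIV_poly assms]) blast
  obtain L where L: "\<And>i. degree (l i) \<le> L" using direction_degree_bound[of l] by blast
  have "real (card {c \<in> poly_box M. mpoly_eval R c = 0}) \<le> ?q ^ L * d * (?q ^ (M * CARD('n)) / ?q ^ M)" for M
  proof -
    have "real (card {c \<in> poly_box M. mpoly_eval R c = 0}) \<le>
        ?q ^ L / ?q ^ M * (\<Sum>c\<in>(poly_box M :: ('n \<Rightarrow> 'a poly) set). real d)"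
    proof (rule card_poly_box_le_average[OF L])
      fix c :: "'n \<Rightarrow> 'a poly"
      obtain p where p: "degree p = d" "lead_coeff p = a" "\<forall>x. poly p x = mpoly_eval R (\<lambda>i. c i + x * l i)"
        using l(2) by blast
      then have "p \<noteq> 0" using l(1) by auto
      have "card {x \<in> polys_below (M - L). mpoly_eval R (\<lambda>i. c i + x * l i) = 0} \<le> card {x. poly p x = 0}"
        using p(3) poly_roots_finite[OF \<open>p \<noteq> 0\<close>] by (intro card_mono) auto
      also have "\<dots> \<le> d" using card_poly_roots_bound[OF \<open>p \<noteq> 0\<close>] p by simp
      finally show "real (card {x \<in> polys_below (M - L). mpoly_eval R (\<lambda>i. c i + x * l i) = 0}) \<le> real d"
        by simp
    qed
    then show ?thesis by (simp add: card_poly_box mult_ac)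
  qed
  then show ?thesis by (intro exI[of _ "?q ^ L * d"]) auto
qed

text \<open>The degree \<open>d\<close> and the leading coefficient \<open>a\<close> are the same on
  every line of the chosen direction, so \<open>card_roots_below\<close> applies with constants
  independent of \<open>c\<close>; the number of residue classes is absorbed by the divisor
  bound.\<close>

lemma card_divisible_poly_box:
  fixes R :: "('n::finite, 'a::{field_gcd,finite} poly) mpoly" and \<epsilon> :: real
  assumes "R \<noteq> 0" "\<epsilon> > 0"
  shows "\<exists>C\<ge>0. \<forall>M r. squarefree r \<longrightarrow> real (card {c \<in> poly_box M. r dvd mpoly_eval R c}) \<le>
    C * real CARD('a) powr (\<epsilon> * degree r) * (real CARD('a) ^ (M * CARD('n)) / real CARD('a) ^ M) *
      (real CARD('a) ^ M / real CARD('a) ^ degree r + 1)"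
proof -
  let ?q = "real CARD('a)"
  have q: "?q \<ge> 1" using card_ge_2_field[where 'a='a] by simp
  obtain i0 :: 'n where True by blast
  obtain d a l where l0: "l i0 = 1" and l: "a \<noteq> 0" "\<And>c. \<exists>p. degree p = d \<and> lead_coeff p = a \<and>
      (\<forall>x. poly p x = mpoly_eval R (\<lambda>i. c i + x * l i))"
    by (rule mpoly_direction[where ?i0.0 = i0, OF infinite_UNIV_poly assms(1)]) blast
  obtain L where L: "\<And>i. degree (l i) \<le> L" using direction_degree_bound[of l] by blast
  obtain C where C: "C \<ge> 1" "\<And>r::'a poly. r \<noteq> 0 \<Longrightarrow>
      real (Suc d) ^ card (prime_factors r) \<le> C * ?q powr (\<epsilon> * degree r)"
    using power_card_prime_factors_bound[of "real (Suc d)" \<epsilon>, where 'a='a] assms(2) by auto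
  have "real (card {c \<in> poly_box M. r dvd mpoly_eval R c}) \<le>
    ?q ^ L * C * ?q ^ degree a * ?q powr (\<epsilon> * degree r) * (?q ^ (M * CARD('n)) / ?q ^ M) * (?q ^ M / ?q ^ degree r + 1)"
    if r: "squarefree r" for M r
  proof -
    let ?B = "C * ?q powr (\<epsilon> * degree r) * (?q ^ degree a * (?q ^ M / ?q ^ degree r + 1))"
    have "real (card {c \<in> poly_box M. r dvd mpoly_eval R c}) \<le>
        ?q ^ L / ?q ^ M * (\<Sum>c\<in>(poly_box M :: ('n \<Rightarrow> 'a poly) set). ?B)"
    proof (rule card_poly_box_le_average[OF L])
      fix c :: "'n \<Rightarrow> 'a poly"
      obtain p where p: "degree p = d" "lead_coeff p = a" "\<forall>x. poly p x = mpoly_eval R (\<lambda>i. c i + x * l i)"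
        using l(2) by blast
      then have "p \<noteq> 0" "r \<noteq> 0" using l(1) r by auto
      have "real (card {x \<in> polys_below (M - L). r dvd mpoly_eval R (\<lambda>i. c i + x * l i)}) =
          real (card {x \<in> polys_below (M - L). r dvd poly p x})" using p(3) by simp
      also have "\<dots> \<le> real (Suc d) ^ card (prime_factors r) *
          (?q ^ degree a * (?q ^ (M - L) / ?q ^ degree r) + 1)"
        using card_roots_below[OF r \<open>p \<noteq> 0\<close>, of "M - L"] unfolding p(2) unfolding p(1) by blast
      also have "\<dots> \<le> ?B"
      proof (rule mult_mono)
        have "?q ^ (M - L) / ?q ^ degree r \<le> ?q ^ M / ?q ^ degree r"
          using q by (intro divide_right_mono power_increasing) auto
        then have "?q ^ degree a * (?q ^ (M - L) / ?q ^ degree r) + 1 \<le>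
            ?q ^ degree a * (?q ^ M / ?q ^ degree r) + ?q ^ degree a"
          using q by (intro add_mono mult_left_mono) auto
        then show "?q ^ degree a * (?q ^ (M - L) / ?q ^ degree r) + 1 \<le> ?q ^ degree a * (?q ^ M / ?q ^ degree r + 1)"
          by (simp only: distrib_left mult_1_right)
      qed (use C \<open>r \<noteq> 0\<close> in auto)
      finally show "real (card {x \<in> polys_below (M - L). r dvd mpoly_eval R (\<lambda>i. c i + x * l i)}) \<le> ?B" .
    qed
    also have "\<dots> = ?q ^ L * C * ?q ^ degree a * ?q powr (\<epsilon> * degree r) * (?q ^ (M * CARD('n)) / ?q ^ M) * (?q ^ M / ?q ^ degree r + 1)"
      by (simp add: card_poly_box mult_ac)
    finally show ?thesis .
  qed
  then show ?thesis using C q by (intro exI[of _ "?q ^ L * C * ?q ^ degree a"]) auto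
qed

lemma degree_mpoly_eval_le:
  fixes R :: "('n::finite, 'a::{field_gcd,finite} poly) mpoly"
  shows "\<exists>D\<ge>1. \<exists>D0. \<forall>M. \<forall>c\<in>poly_box M. degree (mpoly_eval R c) \<le> D * M + D0"
proof -
  let ?K = "Poly_Mapping.keys R"
  define D where "D = (\<Sum>m\<in>?K. \<Sum>i\<in>UNIV. Poly_Mapping.lookup m i)"
  define D0 where "D0 = (\<Sum>m\<in>?K. degree (Poly_Mapping.lookup R m))"
  \<comment> \<open>The successor makes the slope positive even for constant \<open>R\<close>, so
    that \<epsilon> can later be divided by it.\<close>
  have "degree (mpoly_eval R c) \<le> Suc D * M + D0" if c: "c \<in> poly_box M" for M c
    unfolding mpoly_eval_def
  proof (rule degree_sum_le)
    fix m assume m: "m \<in> ?K"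
    have cM: "degree (c i) \<le> M" for i using c by (auto simp: poly_box_def polys_below_altdef dest!: spec[of _ i])
    have "degree (\<Prod>i\<in>UNIV. c i ^ Poly_Mapping.lookup m i) \<le> (\<Sum>i\<in>UNIV. degree (c i ^ Poly_Mapping.lookup m i))"
      by (rule degree_prod_sum_le[OF finite, unfolded o_def])
    also have "\<dots> \<le> (\<Sum>i\<in>UNIV. Poly_Mapping.lookup m i * M)"
    proof (rule sum_mono)
      fix i
      have "degree (c i ^ Poly_Mapping.lookup m i) \<le> degree (c i) * Poly_Mapping.lookup m i" by (rule degree_power_le)
      also have "\<dots> \<le> M * Poly_Mapping.lookup m i" using cM by (intro mult_right_mono) auto
      finally show "degree (c i ^ Poly_Mapping.lookup m i) \<le> Poly_Mapping.lookup m i * M"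
        by (simp add: mult.commute)
    qed
    also have "\<dots> = (\<Sum>i\<in>UNIV. Poly_Mapping.lookup m i) * M" by (simp add: sum_distrib_right)
    also have "\<dots> \<le> D * M"
      unfolding D_def using m by (intro mult_right_mono member_le_sum) auto
    finally have 1: "degree (\<Prod>i\<in>UNIV. c i ^ Poly_Mapping.lookup m i) \<le> D * M" .
    have 2: "degree (Poly_Mapping.lookup R m) \<le> D0"
      unfolding D0_def using m by (intro member_le_sum) auto
    show "degree (Poly_Mapping.lookup R m * (\<Prod>i\<in>UNIV. c i ^ Poly_Mapping.lookup m i)) \<le> Suc D * M + D0"
      using degree_mult_le[of "Poly_Mapping.lookup R m" "\<Prod>i\<in>UNIV. c i ^ Poly_Mapping.lookup m i"] 1 2 by simp
  qed auto
  then show ?thesis by (intro exI[of _ "Suc D"] conjI exI[of _ D0]) auto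
qed

text \<open>
  For small divisors the order of summation is exchanged; for large ones the divisor bound for a
  single value suffices.
\<close>

lemma sum_squarefree_divisors_poly_box:
  fixes R :: "('n::finite, 'a::{field_gcd,finite} poly) mpoly" and \<epsilon> :: real
  assumes "R \<noteq> 0" "\<epsilon> > 0"
  shows "\<exists>C\<ge>0. \<forall>M y. (\<Sum>c\<in>poly_box M. if mpoly_eval R c = 0 then 0
      else real (card {r \<in> squarefree_monics y. r dvd mpoly_eval R c})) \<le>
    C * real CARD('a) powr (\<epsilon> * y) * real CARD('a) ^ (M * CARD('n))"
proof -
  let ?q = "real CARD('a)"
  have q: "?q > 1" using card_ge_2_field[where 'a='a] by simp
  obtain C1 where C1: "C1 \<ge> 0" "\<And>M r. squarefree r \<Longrightarrow> real (card {c \<in> poly_box M. r dvd mpoly_eval R c}) \<le>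
    C1 * ?q powr (\<epsilon> * degree r) * (?q ^ (M * CARD('n)) / ?q ^ M) * (?q ^ M / ?q ^ degree r + 1)"
    using card_divisible_poly_box[OF assms] by blast
  obtain D D0 where D: "D \<ge> 1" "\<And>M c. c \<in> poly_box M \<Longrightarrow> degree (mpoly_eval R c) \<le> D * M + D0"
    using degree_mpoly_eval_le[of R] by blast
  \<comment> \<open>Values of \<open>R\<close> on the box have degree up to about
    \<open>D * M\<close>; dividing \<epsilon> by \<open>D\<close> keeps the divisor bound at
    \<open>q powr (\<epsilon> * M)\<close> up to a constant.\<close>
  define \<delta> where "\<delta> = \<epsilon> / D"
  have \<delta>: "\<delta> > 0" using assms D by (simp add: \<delta>_def)
  obtain C2 where C2: "C2 \<ge> 1" "\<And>r::'a poly. r \<noteq> 0 \<Longrightarrow>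
      2 ^ card (prime_factors r) \<le> C2 * ?q powr (\<delta> * degree r)"
    using power_card_prime_factors_bound[of 2 \<delta>, where 'a='a] \<delta> by auto
  define C where "C = max (2 * C1 * ?q) (C2 * ?q powr (\<delta> * D0))"
  have "(\<Sum>c\<in>poly_box M. if mpoly_eval R c = 0 then 0
      else real (card {r \<in> squarefree_monics y. r dvd mpoly_eval R c})) \<le>
    C * ?q powr (\<epsilon> * y) * ?q ^ (M * CARD('n))" (is "?S \<le> _") for M y
  proof (cases "y \<le> M")
    \<comment> \<open>For \<open>y\<close> at most \<open>M\<close> the summand 1 is dominated by
      \<open>q ^ M / q ^ y\<close>. Each \<open>r\<close> then takes a share of order
      \<open>q powr (\<epsilon> * y) / q ^ y\<close> of the box, and the at most
      \<open>q ^ Suc y\<close> candidates cancel the denominator.\<close>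
    case True
    let ?Y = "squarefree_monics y :: 'a poly set"
    have "?S \<le> (\<Sum>c\<in>poly_box M. real (card {r \<in> ?Y. r dvd mpoly_eval R c}))"
      by (intro sum_mono) auto
    also have "\<dots> = (\<Sum>c\<in>poly_box M. \<Sum>r\<in>?Y. if r dvd mpoly_eval R c then 1 else 0)"
      by (intro sum.cong) (auto simp: sum.If_cases finite_squarefree_monics Int_def)
    also have "\<dots> = (\<Sum>r\<in>?Y. \<Sum>c\<in>poly_box M. if r dvd mpoly_eval R c then 1 else 0)"
      by (rule sum.swap)
    also have "\<dots> = (\<Sum>r\<in>?Y. real (card {c \<in> poly_box M. r dvd mpoly_eval R c}))"
      by (intro sum.cong) (auto simp: sum.If_cases finite_poly_box Int_def)
    also have "\<dots> \<le> (\<Sum>r\<in>?Y. 2 * C1 * ?q powr (\<epsilon> * y) * ?q ^ (M * CARD('n)) / ?q ^ y)"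
    proof (rule sum_mono)
      fix r assume "r \<in> ?Y"
      then have r: "squarefree r" "degree r = y" by (auto simp: squarefree_monics_def)
      have "?q ^ y \<le> ?q ^ M" using q True by (intro power_increasing) auto
      then have "?q ^ M / ?q ^ y + 1 \<le> 2 * (?q ^ M / ?q ^ y)" using q by (simp add: field_simps)
      then have "C1 * ?q powr (\<epsilon> * y) * (?q ^ (M * CARD('n)) / ?q ^ M) * (?q ^ M / ?q ^ y + 1) \<le>
          C1 * ?q powr (\<epsilon> * y) * (?q ^ (M * CARD('n)) / ?q ^ M) * (2 * (?q ^ M / ?q ^ y))"
        using C1(1) by (intro mult_left_mono) auto
      also have "\<dots> = 2 * C1 * ?q powr (\<epsilon> * y) * ?q ^ (M * CARD('n)) / ?q ^ y"
        using q by (simp add: field_simps)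
      finally show "real (card {c \<in> poly_box M. r dvd mpoly_eval R c}) \<le>
          2 * C1 * ?q powr (\<epsilon> * y) * ?q ^ (M * CARD('n)) / ?q ^ y"
        using C1(2)[OF r(1), of M] unfolding r(2) by linarith
    qed
    also have "\<dots> = real (card ?Y) * (2 * C1 * ?q powr (\<epsilon> * y) * ?q ^ (M * CARD('n)) / ?q ^ y)" by simp
    also have "\<dots> \<le> ?q ^ Suc y * (2 * C1 * ?q powr (\<epsilon> * y) * ?q ^ (M * CARD('n)) / ?q ^ y)"
    proof (rule mult_right_mono)
      show "real (card ?Y) \<le> ?q ^ Suc y"
        using of_nat_mono[OF card_squarefree_monics[where 'a='a, of y]] by (simp only: of_nat_power)
    qed (use C1 in auto)
    also have "\<dots> = (2 * C1 * ?q) * (?q powr (\<epsilon> * y) * ?q ^ (M * CARD('n)))"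
      using q by (simp add: field_simps)
    also have "\<dots> \<le> C * (?q powr (\<epsilon> * y) * ?q ^ (M * CARD('n)))"
      unfolding C_def by (intro mult_right_mono) auto
    finally show ?thesis by (simp add: mult.assoc)
  next
    \<comment> \<open>Since \<open>M < y\<close>, the divisor bound
      \<open>q powr (\<epsilon> * M)\<close>, up to a constant, is small enough at every single
      point.\<close>
    case False
    have "?S \<le> (\<Sum>c\<in>(poly_box M :: ('n \<Rightarrow> 'a poly) set). C2 * ?q powr (\<delta> * D0) * ?q powr (\<epsilon> * y))"
    proof (rule sum_mono)
      fix c :: "'n \<Rightarrow> 'a poly" assume c: "c \<in> poly_box M"
      show "(if mpoly_eval R c = 0 then 0 else real (card {r \<in> squarefree_monics y. r dvd mpoly_eval R c}))
          \<le> C2 * ?q powr (\<delta> * D0) * ?q powr (\<epsilon> * y)"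
      proof (cases "mpoly_eval R c = 0")
        case False
        have "real (card {r \<in> squarefree_monics y. r dvd mpoly_eval R c}) \<le>
            2 ^ card (prime_factors (mpoly_eval R c))"
          using of_nat_mono[OF card_squarefree_monic_divisors[OF False, of y], where 'a = real] by simp
        also have "\<dots> \<le> C2 * ?q powr (\<delta> * degree (mpoly_eval R c))" by (rule C2(2)[OF False])
        also have "\<dots> \<le> C2 * ?q powr (\<delta> * D0 + \<epsilon> * y)"
        proof (intro mult_left_mono powr_mono)
          have "real (degree (mpoly_eval R c)) \<le> real (D * M + D0)" using D(2)[OF c] by (rule of_nat_mono)
          then have "\<delta> * degree (mpoly_eval R c) \<le> \<delta> * real (D * M + D0)"
            using \<delta> by (intro mult_left_mono) auto
          also have "\<dots> = \<delta> * D0 + \<epsilon> * M" using D(1) by (simp add: \<delta>_def field_simps)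
          also have "\<dots> \<le> \<delta> * D0 + \<epsilon> * y" using \<open>\<not> y \<le> M\<close> assms by simp
          finally show "\<delta> * degree (mpoly_eval R c) \<le> \<delta> * D0 + \<epsilon> * y" .
        qed (use C2 q in auto)
        also have "\<dots> = C2 * ?q powr (\<delta> * D0) * ?q powr (\<epsilon> * y)" by (simp add: powr_add)
        finally show ?thesis using False by simp
      qed (use C2 in auto)
    qed
    also have "\<dots> = C2 * ?q powr (\<delta> * D0) * (?q powr (\<epsilon> * y) * ?q ^ (M * CARD('n)))"
      by (simp add: card_poly_box mult_ac)
    also have "\<dots> \<le> C * (?q powr (\<epsilon> * y) * ?q ^ (M * CARD('n)))"
      unfolding C_def by (intro mult_right_mono) auto
    finally show ?thesis by (simp add: mult.assoc)
  qed
  moreover have "C \<ge> 0" unfolding C_def using C1(1) q by (intro max.coboundedI1) simp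
  ultimately show ?thesis by blast
qed

text \<open>The number of points on a line is at most the number of candidates for \<open>r\<close>
  times the number of roots of \<open>H0\<close> modulo one candidate. The second factor is bounded
  uniformly over all lines, so only the first has to be averaged over the box.\<close>

lemma card_common_divisor_poly_box:
  fixes H0 H1 :: "('n::finite, 'a::{field_gcd,finite} poly) mpoly" and \<epsilon> :: real
  assumes cop: "relatively_prime (mpoly_to_fract H0) (mpoly_to_fract H1)"
    and "H0 \<noteq> 0" "\<epsilon> > 0"
  shows "\<exists>C\<ge>0. \<forall>M y. real (card {c \<in> poly_box M. \<exists>r\<in>squarefree_monics y.
      r dvd mpoly_eval H0 c \<and> r dvd mpoly_eval H1 c}) \<le>
    C * real CARD('a) powr (\<epsilon> * y) * (real CARD('a) ^ (M * CARD('n)) / real CARD('a) ^ y +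
      real CARD('a) ^ (M * CARD('n)) / real CARD('a) ^ M)"
proof -
  let ?q = "real CARD('a)"
  have q: "?q \<ge> 1" using card_ge_2_field[where 'a='a] by simp
  \<comment> \<open>One half of \<epsilon> pays for the number of candidates \<open>r\<close>, the
    other for the residue classes modulo each of them.\<close>
  have \<epsilon>2: "\<epsilon> / 2 > 0" using assms by simp
  obtain i0 :: 'n where True by blast
  obtain d a l where l: "l i0 = 1" "a \<noteq> 0" "\<And>c. \<exists>p. degree p = d \<and> lead_coeff p = a \<and>
      (\<forall>x. poly p x = mpoly_eval H0 (\<lambda>i. c i + x * l i))"
    by (rule mpoly_direction[where ?i0.0 = i0, OF infinite_UNIV_poly \<open>H0 \<noteq> 0\<close>]) blast
  obtain L where L: "\<And>i. degree (l i) \<le> L" using direction_degree_bound[of l] by blast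
  obtain R A B where R: "R \<noteq> 0"
    "\<And>c. mpoly_eval R c = mpoly_eval A c * mpoly_eval H0 c + mpoly_eval B c * mpoly_eval H1 c"
    "\<And>c x. mpoly_eval R (\<lambda>i. c i + x * l i) = mpoly_eval R c"
    by (rule invariant_eliminant[where l = l and ?i0.0 = i0, OF infinite_UNIV_poly cop \<open>H0 \<noteq> 0\<close> l(1)]) blast
  obtain C1 where C1: "C1 \<ge> 0" "\<And>M. real (card {c \<in> poly_box M. mpoly_eval R c = 0}) \<le>
      C1 * (?q ^ (M * CARD('n)) / ?q ^ M)"
    using card_zeros_poly_box[OF R(1)] by blast
  obtain C2 where C2: "C2 \<ge> 0" "\<And>M y. (\<Sum>c\<in>poly_box M. if mpoly_eval R c = 0 then 0
      else real (card {r \<in> squarefree_monics y. r dvd mpoly_eval R c})) \<le>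
    C2 * ?q powr (\<epsilon> / 2 * y) * ?q ^ (M * CARD('n))"
    using sum_squarefree_divisors_poly_box[OF R(1) \<epsilon>2] by blast
  obtain C3 where C3: "C3 \<ge> 1" "\<And>r::'a poly. r \<noteq> 0 \<Longrightarrow>
      real (Suc d) ^ card (prime_factors r) \<le> C3 * ?q powr (\<epsilon> / 2 * degree r)"
    using power_card_prime_factors_bound[OF _ \<epsilon>2, of "real (Suc d)", where 'a='a] by auto
  define C where "C = C1 + ?q ^ L * C3 * ?q ^ degree a * C2"
  have "real (card {c \<in> poly_box M. \<exists>r\<in>squarefree_monics y. r dvd mpoly_eval H0 c \<and> r dvd mpoly_eval H1 c}) \<le>
    C * ?q powr (\<epsilon> * y) * (?q ^ (M * CARD('n)) / ?q ^ y + ?q ^ (M * CARD('n)) / ?q ^ M)" for M y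
  proof -
    let ?Y = "squarefree_monics y :: 'a poly set"
    \<comment> \<open>\<open>H1\<close> enters only through \<open>R\<close>: a common divisor of
      both values divides the value of \<open>R\<close>. In \<open>?P\<close> the polynomial
      \<open>R\<close> lists the candidates and \<open>H0\<close> locates the points.\<close>
    let ?P = "\<lambda>c. mpoly_eval R c \<noteq> 0 \<and> (\<exists>r\<in>?Y. r dvd mpoly_eval R c \<and> r dvd mpoly_eval H0 c)"
    let ?N = "\<lambda>c. if mpoly_eval R c = 0 then 0 else real (card {r \<in> ?Y. r dvd mpoly_eval R c})"
    let ?E = "C3 * ?q powr (\<epsilon> / 2 * y) * (?q ^ degree a * (?q ^ M / ?q ^ y + 1))"
    have E0: "?E \<ge> 0" using C3 by simp
    have "real (card {c \<in> poly_box M. ?P c}) \<le> ?q ^ L / ?q ^ M * (\<Sum>c\<in>poly_box M. ?N c * ?E)"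
    proof (rule card_poly_box_le_average[OF L])
      fix c :: "'n \<Rightarrow> 'a poly"
      obtain p where p: "degree p = d" "lead_coeff p = a" "\<forall>x. poly p x = mpoly_eval H0 (\<lambda>i. c i + x * l i)"
        using l(3) by blast
      then have "p \<noteq> 0" using l(2) by auto
      let ?X = "polys_below (M - L) :: 'a poly set"
      show "real (card {x \<in> ?X. ?P (\<lambda>i. c i + x * l i)}) \<le> ?N c * ?E"
      proof (cases "mpoly_eval R c = 0")
        case False
        let ?Z = "{r \<in> ?Y. r dvd mpoly_eval R c}"
        have finZ: "finite ?Z" using finite_squarefree_monics by (rule rev_finite_subset) auto
        have fin: "finite {x \<in> ?X. r dvd poly p x}" for r
          using finite_polys_below by (rule rev_finite_subset) auto
        have each: "real (card {x \<in> ?X. r dvd poly p x}) \<le> ?E" if "r \<in> ?Z" for r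
        proof -
          have r: "squarefree r" "degree r = y" "r \<noteq> 0" using that by (auto simp: squarefree_monics_def)
          have "real (card {x \<in> ?X. r dvd poly p x}) \<le> real (Suc d) ^ card (prime_factors r) *
              (?q ^ degree a * (?q ^ (M - L) / ?q ^ y) + 1)"
            using card_roots_below[OF r(1) \<open>p \<noteq> 0\<close>, of "M - L"] unfolding p(2) r(2) unfolding p(1) by blast
          also have "\<dots> \<le> ?E"
          proof (rule mult_mono)
            have "?q ^ (M - L) / ?q ^ y \<le> ?q ^ M / ?q ^ y"
              using q by (intro divide_right_mono power_increasing) auto
            then have "?q ^ degree a * (?q ^ (M - L) / ?q ^ y) + 1 \<le>
                ?q ^ degree a * (?q ^ M / ?q ^ y) + ?q ^ degree a"
              using q by (intro add_mono mult_left_mono) auto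
            then show "?q ^ degree a * (?q ^ (M - L) / ?q ^ y) + 1 \<le> ?q ^ degree a * (?q ^ M / ?q ^ y + 1)"
              by (simp only: distrib_left mult_1_right)
            show "real (Suc d) ^ card (prime_factors r) \<le> C3 * ?q powr (\<epsilon> / 2 * y)"
              using C3(2)[OF r(3)] unfolding r(2) .
          qed (use C3 in auto)
          finally show ?thesis .
        qed
        \<comment> \<open>Invariance is used here: the candidates at \<open>c + x * l\<close> are
          those at \<open>c\<close>, so the union runs over a set \<open>?Z\<close> that does not
          depend on \<open>x\<close>.\<close>
        have "{x \<in> ?X. ?P (\<lambda>i. c i + x * l i)} \<subseteq> (\<Union>r\<in>?Z. {x \<in> ?X. r dvd poly p x})"
          unfolding R(3) using p(3) by auto
        then have "card {x \<in> ?X. ?P (\<lambda>i. c i + x * l i)} \<le> card (\<Union>r\<in>?Z. {x \<in> ?X. r dvd poly p x})"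
          using finZ fin by (intro card_mono finite_UN_I) auto
        also have "\<dots> \<le> (\<Sum>r\<in>?Z. card {x \<in> ?X. r dvd poly p x})" using finZ by (rule card_UN_le)
        finally have "real (card {x \<in> ?X. ?P (\<lambda>i. c i + x * l i)}) \<le>
            real (\<Sum>r\<in>?Z. card {x \<in> ?X. r dvd poly p x})" by (rule of_nat_mono)
        also have "\<dots> = (\<Sum>r\<in>?Z. real (card {x \<in> ?X. r dvd poly p x}))" by simp
        also have "\<dots> \<le> (\<Sum>r\<in>?Z. ?E)" by (rule sum_mono) (rule each)
        also have "\<dots> = ?N c * ?E" using False by simp
        finally show ?thesis .
      qed (simp add: R(3))
    qed
    also have "(\<Sum>c\<in>poly_box M. ?N c * ?E) = (\<Sum>c\<in>poly_box M. ?N c) * ?E"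
      by (rule sum_distrib_right[symmetric])
    also have "?q ^ L / ?q ^ M * ((\<Sum>c\<in>poly_box M. ?N c) * ?E) \<le>
        ?q ^ L / ?q ^ M * ((C2 * ?q powr (\<epsilon> / 2 * y) * ?q ^ (M * CARD('n))) * ?E)"
      using C2(2) E0 by (intro mult_left_mono mult_right_mono) auto
    also have "\<dots> = (?q ^ L * C3 * ?q ^ degree a * C2) * (?q powr (\<epsilon> / 2 * y) * ?q powr (\<epsilon> / 2 * y)) *
        (?q ^ (M * CARD('n)) / ?q ^ y + ?q ^ (M * CARD('n)) / ?q ^ M)"
      using q by (simp add: field_simps)
    also have "?q powr (\<epsilon> / 2 * y) * ?q powr (\<epsilon> / 2 * y) = ?q powr (\<epsilon> * y)"
      by (simp flip: powr_add)
    finally have P: "real (card {c \<in> poly_box M. ?P c}) \<le> (?q ^ L * C3 * ?q ^ degree a * C2) * ?q powr (\<epsilon> * y) *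
        (?q ^ (M * CARD('n)) / ?q ^ y + ?q ^ (M * CARD('n)) / ?q ^ M)" .
    \<comment> \<open>The zeros of \<open>R\<close> fall under the second term of the bound;
      inserting a factor that is at least 1 gives them the common form.\<close>
    have "1 \<le> ?q powr (\<epsilon> * y)" using q assms by (intro ge_one_powr_ge_zero) auto
    then have "C1 * (1 * (?q ^ (M * CARD('n)) / ?q ^ M)) \<le>
        C1 * (?q powr (\<epsilon> * y) * (?q ^ (M * CARD('n)) / ?q ^ y + ?q ^ (M * CARD('n)) / ?q ^ M))"
      using C1(1) q by (intro mult_left_mono mult_mono) auto
    then have Z: "real (card {c \<in> poly_box M. mpoly_eval R c = 0}) \<le>
        C1 * ?q powr (\<epsilon> * y) * (?q ^ (M * CARD('n)) / ?q ^ y + ?q ^ (M * CARD('n)) / ?q ^ M)"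
      using C1(2)[of M] by (simp only: mult_1_left mult.assoc)
    have "r dvd mpoly_eval R c" if "r dvd mpoly_eval H0 c" "r dvd mpoly_eval H1 c" for r c
      unfolding R(2) using that by simp
    then have "{c \<in> poly_box M. \<exists>r\<in>?Y. r dvd mpoly_eval H0 c \<and> r dvd mpoly_eval H1 c} \<subseteq>
        {c \<in> poly_box M. mpoly_eval R c = 0} \<union> {c \<in> poly_box M. ?P c}"
      by blast
    moreover have "finite {c \<in> (poly_box M :: ('n \<Rightarrow> 'a poly) set). Q c}" for Q
      using finite_poly_box by (rule rev_finite_subset) auto
    ultimately have "card {c \<in> poly_box M. \<exists>r\<in>?Y. r dvd mpoly_eval H0 c \<and> r dvd mpoly_eval H1 c} \<le>
        card {c \<in> poly_box M. mpoly_eval R c = 0} + card {c \<in> poly_box M. ?P c}"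
      by (intro order.trans[OF card_mono card_Un_le]) auto
    then have "real (card {c \<in> poly_box M. \<exists>r\<in>?Y. r dvd mpoly_eval H0 c \<and> r dvd mpoly_eval H1 c}) \<le>
        real (card {c \<in> poly_box M. mpoly_eval R c = 0}) + real (card {c \<in> poly_box M. ?P c})"
      by linarith
    then show ?thesis using P Z unfolding C_def by (simp only: distrib_right)
  qed
  moreover have "C \<ge> 0" unfolding C_def using C1(1) C2(1) C3(1) by simp
  ultimately show ?thesis by blast
qed

section \<open>From real parameters to boxes\<close>

lemma relatively_prime_commute: "relatively_prime a b \<longleftrightarrow> relatively_prime b a"
  unfolding relatively_prime_def by blast

lemma degree_le_of_poly_norm_le:
  fixes a :: "'a::{field_gcd,finite} poly"
  assumes "poly_norm a \<le> hat TYPE('a) T" "a \<noteq> 0"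
  shows "real (degree a) \<le> T"
proof -
  have "real CARD('a) > 1" using card_ge_2_field[where 'a='a] by simp
  moreover from this have "real CARD('a) powr degree a \<le> real CARD('a) powr T"
    using assms by (simp add: poly_norm_def hat_def powr_realpow)
  ultimately show ?thesis by simp
qed

theorem theorem7p2:
  fixes H0 H1 :: "('n::finite, 'a::{field_gcd,finite} poly) mpoly"
    and \<epsilon> :: real
  assumes "relatively_prime (mpoly_to_fract H0) (mpoly_to_fract H1)"
    and "\<epsilon> > 0"
  shows "\<exists>C::real. \<forall>T Y :: real. T > 0 \<longrightarrow> Y > 0 \<longrightarrow>
    real (card {c :: 'n \<Rightarrow> 'a poly. vec_norm c \<le> hat TYPE('a) T \<and>
      (\<exists>r. lead_coeff r = 1 \<and> squarefree r \<and>
           r dvd gcd (mpoly_eval H0 c) (mpoly_eval H1 c) \<and> poly_norm r = hat TYPE('a) Y)})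
    \<le> C * (hat TYPE('a) Y powr \<epsilon> *
        (hat TYPE('a) T ^ CARD('n) / hat TYPE('a) Y + hat TYPE('a) T ^ (CARD('n) - 1)))"
proof -
  let ?q = "real CARD('a)" and ?n = "CARD('n)"
  let ?good = "\<lambda>c r. r dvd mpoly_eval H0 c \<and> r dvd mpoly_eval H1 c"
  have q: "?q > 1" using card_ge_2_field[where 'a='a] by simp
  have "\<exists>C\<ge>0. \<forall>M y. real (card {c \<in> poly_box M. \<exists>r\<in>squarefree_monics y. ?good c r}) \<le>
      C * ?q powr (\<epsilon> * y) * (?q ^ (M * ?n) / ?q ^ y + ?q ^ (M * ?n) / ?q ^ M)"
  proof (cases "H0 = 0")
    case False
    then show ?thesis using card_common_divisor_poly_box assms by blast
  next
    \<comment> \<open>If both polynomials were zero, 0 would be a common divisor, and it does not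
      divide 1. So \<open>H1\<close> is nonzero and the two exchange roles.\<close>
    case True
    have "H1 \<noteq> 0"
    proof
      assume "H1 = 0"
      moreover have "mpoly_to_fract 0 = (0 :: ('n, 'a poly fract) mpoly)"
        unfolding mpoly_to_fract_def by (simp add: map_eq_zero_iff)
      ultimately have "(0 :: ('n, 'a poly fract) mpoly) dvd 1"
        using assms(1) True by (simp add: relatively_prime_def)
      then show False by simp
    qed
    moreover have "relatively_prime (mpoly_to_fract H1) (mpoly_to_fract H0)"
      using assms(1) by (subst relatively_prime_commute)
    moreover have swap: "?good c r \<longleftrightarrow> r dvd mpoly_eval H1 c \<and> r dvd mpoly_eval H0 c" for c r
      by blast
    ultimately show ?thesis
      unfolding swap using card_common_divisor_poly_box assms(2) by blast
  qed
  then obtain C where C: "C \<ge> 0" "\<And>M y. real (card {c \<in> poly_box M. \<exists>r\<in>squarefree_monics y. ?good c r}) \<le>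
      C * ?q powr (\<epsilon> * y) * (?q ^ (M * ?n) / ?q ^ y + ?q ^ (M * ?n) / ?q ^ M)"
    by blast
  show ?thesis
  \<comment> \<open>Rounding \<open>T\<close> up to the integer \<open>M\<close> costs at most a
    factor \<open>q\<close> in each of the \<open>?n\<close> coordinates.\<close>
  proof (intro exI[of _ "C * ?q ^ ?n"] allI impI)
    fix T Y :: real assume T: "T > 0" and Y: "Y > 0"
    let ?S = "{c :: 'n \<Rightarrow> 'a poly. vec_norm c \<le> hat TYPE('a) T \<and>
      (\<exists>r. lead_coeff r = 1 \<and> squarefree r \<and>
           r dvd gcd (mpoly_eval H0 c) (mpoly_eval H1 c) \<and> poly_norm r = hat TYPE('a) Y)}"
    let ?t = "hat TYPE('a) T" and ?y = "hat TYPE('a) Y"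
    have pos: "?t > 0" "?y > 0" using q by (auto simp: hat_def)
    show "real (card ?S) \<le> C * ?q ^ ?n * (?y powr \<epsilon> * (?t ^ ?n / ?y + ?t ^ (?n - 1)))"
    proof (cases "\<exists>y::nat. Y = y")
      case True
      then obtain y :: nat where y: "Y = y" by blast
      \<comment> \<open>\<open>polys_below\<close> bounds the degree strictly, so degrees up to the
        floor of \<open>T\<close> require its successor.\<close>
      define M where "M = Suc (nat \<lfloor>T\<rfloor>)"
      have yq: "?y = ?q ^ y" using q by (simp add: y hat_def powr_realpow)
      have "?S \<subseteq> {c \<in> poly_box M. \<exists>r\<in>squarefree_monics y. ?good c r}"
      proof
        fix c assume c: "c \<in> ?S"
        have "c i \<in> polys_below M" for i
        proof -
          have "poly_norm (c i) \<le> vec_norm c" unfolding vec_norm_def by (intro Max_ge) auto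
          then have "poly_norm (c i) \<le> ?t" using c by simp
          then have "c i = 0 \<or> real (degree (c i)) \<le> T" using degree_le_of_poly_norm_le by blast
          then show ?thesis using T by (auto simp: polys_below_altdef M_def le_nat_iff le_floor_iff less_Suc_eq_le)
        qed
        then have "c \<in> poly_box M" by (simp add: poly_box_def)
        moreover obtain r where r: "lead_coeff r = 1" "squarefree r"
          "r dvd gcd (mpoly_eval H0 c) (mpoly_eval H1 c)" "poly_norm r = ?y" using c by blast
        moreover have "r \<noteq> 0" using r(1) by auto
        moreover from this have "degree r = y"
          using r(4) q unfolding yq poly_norm_def by simp
        ultimately show "c \<in> {c \<in> poly_box M. \<exists>r\<in>squarefree_monics y. ?good c r}"
          by (auto simp: squarefree_monics_def)
      qed
      then have "card ?S \<le> card {c \<in> poly_box M. \<exists>r\<in>squarefree_monics y. ?good c r}"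
        by (intro card_mono finite_subset[OF _ finite_poly_box[of M]]) auto
      then have "real (card ?S) \<le> C * ?q powr (\<epsilon> * y) * (?q ^ (M * ?n) / ?q ^ y + ?q ^ (M * ?n) / ?q ^ M)"
        using C(2)[of M y] by linarith
      also have "\<dots> \<le> C * ?q powr (\<epsilon> * y) * (?q ^ ?n * (?t ^ ?n / ?y + ?t ^ (?n - 1)))"
      proof (rule mult_left_mono)
        have "real M \<le> T + 1" using T by (simp add: M_def)
        then have "?q powr M \<le> ?q powr (T + 1)" using q by simp
        then have M: "?q ^ M \<le> ?q * ?t"
          using q by (simp add: hat_def powr_realpow powr_add mult.commute)
        have "?q ^ (M * ?n) \<le> ?q ^ ?n * ?t ^ ?n"
          using power_mono[OF M, of ?n] q by (simp add: power_mult power_mult_distrib)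
        then have 1: "?q ^ (M * ?n) / ?q ^ y \<le> ?q ^ ?n * (?t ^ ?n / ?y)"
          unfolding yq using q by (simp add: divide_right_mono)
        have "?q ^ (M * ?n) / ?q ^ M = (?q ^ M) ^ (?n - 1)"
          unfolding power_mult using power_minus_mult[of ?n "?q ^ M"] q by (simp add: field_simps)
        also have "\<dots> \<le> (?q * ?t) ^ (?n - 1)" using M q by (intro power_mono) auto
        also have "\<dots> = ?q ^ (?n - 1) * ?t ^ (?n - 1)" by (rule power_mult_distrib)
        also have "\<dots> \<le> ?q ^ ?n * ?t ^ (?n - 1)"
          using q pos by (intro mult_right_mono power_increasing) auto
        finally show "?q ^ (M * ?n) / ?q ^ y + ?q ^ (M * ?n) / ?q ^ M \<le> ?q ^ ?n * (?t ^ ?n / ?y + ?t ^ (?n - 1))"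
          using 1 by (simp add: distrib_left)
      qed (use C in auto)
      also have "?q powr (\<epsilon> * y) = ?y powr \<epsilon>"
        by (simp add: hat_def y powr_powr mult.commute)
      finally show ?thesis by (simp add: mult_ac)
    next
      \<comment> \<open>Norms of nonzero polynomials are natural powers of \<open>q\<close>, so for
        every other \<open>Y\<close> the set is empty.\<close>
      case False
      have "poly_norm r \<noteq> ?y" if "lead_coeff r = 1" for r :: "'a poly"
      proof
        assume "poly_norm r = ?y"
        moreover have "r \<noteq> 0" using that by auto
        ultimately have "?q powr degree r = ?q powr Y"
          using q by (simp add: poly_norm_def hat_def powr_realpow)
        then show False using q False powr_inj[of ?q "degree r" Y] by auto
      qed
      then have "?S = {}" by blast
      then have "card ?S = 0" by (simp only: card.empty)
      moreover have "0 \<le> C * ?q ^ ?n * (?y powr \<epsilon> * (?t ^ ?n / ?y + ?t ^ (?n - 1)))"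
        using C(1) pos by (intro mult_nonneg_nonneg add_nonneg_nonneg divide_nonneg_nonneg) auto
      ultimately show ?thesis by (simp only: of_nat_0)
    qed
  qed
qed

end
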